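(* Let $\Gamma$ be an infinite group that is not uniformly locally finite. Then the class of $\Gamma$-gain-graphic matroids is not $\mathrm{CMSO}_1$-definable.
   Context: **Uniform local finiteness.** A group $\Gamma$ is uniformly locally finite if there is a function $g_\Gamma$ from positive integers to positive integers such that, for every positive integer $k$, any subgroup of $\Gamma$ generated by at most $k$ elements has size at most $g_\Gamma(k)$. **Hypergraphs, matroids and logic.** A hypergraph is a pair $(E,\mathcal{I})$ with $E$ a finite set and $\mathcal{I}$ a collection of subsets of $E$ (hyperedges). A matroid is regarded as the hypergraph whose hyperedges are its independent sets. Counting monadic second-order logic $\mathrm{CMSO}_1$ of hypergraphs has set variables $Z_1,Z_2,\ldots$ ranging over subsets of $E$; its formulas are built using $\neg$, $\land$ and $\exists Z_i$ from the atomic formulas $Z_i\subseteq Z_j$, $\mathsf{hyp}(Z_i)$ (meaning $Z_i$ is a hyperedge), and $|Z_i|\equiv p\bmod q$ (integers $q>1$, $0\le p<q$), with the usual semantics. A class $\mathcal{M}$ of hypergraphs is $\mathrm{CMSO}_1$-definable if there is a $\mathrm{CMSO}_1$-sentence $\varphi$ such that a hypergraph satisfies $\varphi$ if and only if it belongs to $\mathcal{M}$. **Gain-graphic matroids.** Graphs are finite and may have loops and parallel edges. A $\Gamma$-gaining of a graph $G$ is a function $\sigma$ assigning an element $\sigma(e,u,v)\in\Gamma$ to each triple $(e,u,v)$ where either $e$ is an edge joining distinct vertices $u,v$, or $e$ is a loop at $u$ and $u=v$; it is required that $\sigma(e,u,v)=\sigma(e,v,u)^{-1}$ when $u\neq v$.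 For a walk $W=v_0,e_0,v_1,\ldots,e_{n-1},v_n$ let $\sigma(W)=\sigma(e_0,v_0,v_1)\cdots\sigma(e_{n-1},v_{n-1},v_n)$. A cycle is balanced if $\sigma$ evaluates to the identity when the cycle is traversed from some (equivalently, any) starting point and direction; $\mathcal{B}(\sigma)$ is the set of balanced cycles. A bicycle is a set $X$ of edges that is minimal subject to the subgraph $G[X]$ (edges $X$ and their incident vertices) being connected and containing at least two cycles. The frame matroid $F(G,\sigma)$ has ground set $E(G)$, and its circuits are the edge-sets of balanced cycles and the bicycles containing no balanced cycle. A matroid is $\Gamma$-gain-graphic if it equals $F(G,\sigma)$ for some graph $G$ and some $\Gamma$-gaining $\sigma$ of $G$. *)

theory Defs
  imports "HOL-Algebra.Generated_Groups"
begin

section \<open>Uniformly locally finite groups\<close>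

definition uniformly_locally_finite :: "('g, 'm) monoid_scheme \<Rightarrow> bool" where
  "uniformly_locally_finite \<Gamma> \<longleftrightarrow>
     (\<exists>g :: nat \<Rightarrow> nat. (\<forall>k \<ge> 1. g k \<ge> 1) \<and>
        (\<forall>k \<ge> 1. \<forall>A. A \<subseteq> carrier \<Gamma> \<and> finite A \<and> card A \<le> k \<longrightarrow>
           finite (generate \<Gamma> A) \<and> card (generate \<Gamma> A) \<le> g k))"


section \<open>Hypergraphs and counting monadic second-order logic\<close>

type_synonym 'e hypergraph = "'e set \<times> 'e set set"

definition is_hypergraph :: "'e hypergraph \<Rightarrow> bool" where
  "is_hypergraph H \<longleftrightarrow> finite (fst H) \<and> snd H \<subseteq> Pow (fst H)"

text \<open>The atom \<open>CardMod i p q\<close> stands for \<open>|Z\<^sub>i| \<equiv> p mod q\<close>; the side condition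
  \<open>0 \<le> p < q\<close>, \<open>q > 1\<close> on formulas is imposed by \<open>well_formed\<close> below.\<close>

datatype cmso =
    Subset nat nat
  | Hyp nat
  | CardMod nat nat nat
  | Neg cmso
  | Conj cmso cmso
  | Exists nat cmso

primrec well_formed :: "cmso \<Rightarrow> bool" where
  "well_formed (Subset i j) = True"
| "well_formed (Hyp i) = True"
| "well_formed (CardMod i p q) = (q > 1 \<and> p < q)"
| "well_formed (Neg \<phi>) = well_formed \<phi>"
| "well_formed (Conj \<phi> \<psi>) = (well_formed \<phi> \<and> well_formed \<psi>)"
| "well_formed (Exists i \<phi>) = well_formed \<phi>"

primrec free_vars :: "cmso \<Rightarrow> nat set" where
  "free_vars (Subset i j) = {i, j}"
| "free_vars (Hyp i) = {i}"
| "free_vars (CardMod i p q) = {i}"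
| "free_vars (Neg \<phi>) = free_vars \<phi>"
| "free_vars (Conj \<phi> \<psi>) = free_vars \<phi> \<union> free_vars \<psi>"
| "free_vars (Exists i \<phi>) = free_vars \<phi> - {i}"

primrec sat :: "'e hypergraph \<Rightarrow> (nat \<Rightarrow> 'e set) \<Rightarrow> cmso \<Rightarrow> bool" where
  "sat H \<theta> (Subset i j) = (\<theta> i \<subseteq> \<theta> j)"
| "sat H \<theta> (Hyp i) = (\<theta> i \<in> snd H)"
| "sat H \<theta> (CardMod i p q) = (card (\<theta> i) mod q = p mod q)"
| "sat H \<theta> (Neg \<phi>) = (\<not> sat H \<theta> \<phi>)"
| "sat H \<theta> (Conj \<phi> \<psi>) = (sat H \<theta> \<phi> \<and> sat H \<theta> \<psi>)"
| "sat H \<theta> (Exists i \<phi>) = (\<exists>X. X \<subseteq> fst H \<and> sat H (\<theta>(i := X)) \<phi>)"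

definition is_sentence :: "cmso \<Rightarrow> bool" where
  "is_sentence \<phi> \<longleftrightarrow> well_formed \<phi> \<and> free_vars \<phi> = {}"

text \<open>For sentences the choice of the assignment \<open>\<theta>\<close> is irrelevant.\<close>

definition satisfies :: "'e hypergraph \<Rightarrow> cmso \<Rightarrow> bool" where
  "satisfies H \<phi> \<longleftrightarrow> (\<forall>\<theta>. (\<forall>i. \<theta> i \<subseteq> fst H) \<longrightarrow> sat H \<theta> \<phi>)"

definition cmso1_definable :: "'e hypergraph set \<Rightarrow> bool" where
  "cmso1_definable \<M> \<longleftrightarrow>
     (\<exists>\<phi>. is_sentence \<phi> \<and> (\<forall>H. is_hypergraph H \<longrightarrow> (satisfies H \<phi> \<longleftrightarrow> H \<in> \<M>)))"


section \<open>Graphs\<close>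

text \<open>An edge \<open>e\<close> joins \<open>u\<close> and \<open>v\<close> iff \<open>ends G e = {u, v}\<close>, so \<open>e\<close> is a loop at \<open>u\<close>
  iff \<open>ends G e = {u}\<close>. The values of \<open>ends G\<close> outside \<open>edges G\<close> are irrelevant.\<close>

record ('v, 'e) graph =
  verts :: "'v set"
  edges :: "'e set"
  ends :: "'e \<Rightarrow> 'v set"

definition is_graph :: "('v, 'e) graph \<Rightarrow> bool" where
  "is_graph G \<longleftrightarrow> finite (verts G) \<and> finite (edges G) \<and>
     (\<forall>e \<in> edges G. \<exists>u \<in> verts G. \<exists>v \<in> verts G. ends G e = {u, v})"

text \<open>The walk \<open>v\<^sub>0, e\<^sub>0, v\<^sub>1, \<dots>, e\<^sub>n\<^sub>-\<^sub>1, v\<^sub>n\<close> is given by its list of vertices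
  and its list of edges.\<close>

definition is_walk :: "('v, 'e) graph \<Rightarrow> 'v list \<Rightarrow> 'e list \<Rightarrow> bool" where
  "is_walk G vs es \<longleftrightarrow> length vs = Suc (length es) \<and> set vs \<subseteq> verts G \<and>
     (\<forall>i < length es. es ! i \<in> edges G \<and> ends G (es ! i) = {vs ! i, vs ! Suc i})"

text \<open>Distinctness of the edges excludes going back and forth along one edge.\<close>

definition traverses_cycle :: "('v, 'e) graph \<Rightarrow> 'v list \<Rightarrow> 'e list \<Rightarrow> bool" where
  "traverses_cycle G vs es \<longleftrightarrow> is_walk G vs es \<and> es \<noteq> [] \<and> hd vs = last vs \<and>
     distinct (tl vs) \<and> distinct es"

text \<open>Cycles are identified with their edge sets.\<close>

definition cycles :: "('v, 'e) graph \<Rightarrow> 'e set set" where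
  "cycles G = {set es | vs es. traverses_cycle G vs es}"

definition connected_graph :: "('v, 'e) graph \<Rightarrow> bool" where
  "connected_graph G \<longleftrightarrow>
     (\<forall>u \<in> verts G. \<forall>v \<in> verts G. \<exists>vs es. is_walk G vs es \<and> hd vs = u \<and> last vs = v)"

definition edge_subgraph :: "('v, 'e) graph \<Rightarrow> 'e set \<Rightarrow> ('v, 'e) graph" where
  "edge_subgraph G X = \<lparr>verts = (\<Union>e \<in> X. ends G e), edges = X, ends = ends G\<rparr>"

definition connected_two_cycles :: "('v, 'e) graph \<Rightarrow> 'e set \<Rightarrow> bool" where
  "connected_two_cycles G X \<longleftrightarrow> connected_graph (edge_subgraph G X) \<and>
     (\<exists>C \<in> cycles (edge_subgraph G X). \<exists>D \<in> cycles (edge_subgraph G X). C \<noteq> D)"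

definition bicycles :: "('v, 'e) graph \<Rightarrow> 'e set set" where
  "bicycles G = {X. X \<subseteq> edges G \<and> connected_two_cycles G X \<and>
     (\<forall>Y. Y \<subset> X \<longrightarrow> \<not> connected_two_cycles G Y)}"


section \<open>Gain graphs and their frame matroids\<close>

definition is_gaining ::
  "('g, 'm) monoid_scheme \<Rightarrow> ('v, 'e) graph \<Rightarrow> ('e \<Rightarrow> 'v \<Rightarrow> 'v \<Rightarrow> 'g) \<Rightarrow> bool" where
  "is_gaining \<Gamma> G \<sigma> \<longleftrightarrow>
     (\<forall>e \<in> edges G. \<forall>u v. ends G e = {u, v} \<longrightarrow>
        \<sigma> e u v \<in> carrier \<Gamma> \<and> (u \<noteq> v \<longrightarrow> \<sigma> e u v = inv\<^bsub>\<Gamma>\<^esub> (\<sigma> e v u)))"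

fun walk_gain ::
  "('g, 'm) monoid_scheme \<Rightarrow> ('e \<Rightarrow> 'v \<Rightarrow> 'v \<Rightarrow> 'g) \<Rightarrow> 'v list \<Rightarrow> 'e list \<Rightarrow> 'g" where
  "walk_gain \<Gamma> \<sigma> (u # v # vs) (e # es) = \<sigma> e u v \<otimes>\<^bsub>\<Gamma>\<^esub> walk_gain \<Gamma> \<sigma> (v # vs) es"
| "walk_gain \<Gamma> \<sigma> _ _ = \<one>\<^bsub>\<Gamma>\<^esub>"

definition balanced_cycles ::
  "('g, 'm) monoid_scheme \<Rightarrow> ('v, 'e) graph \<Rightarrow> ('e \<Rightarrow> 'v \<Rightarrow> 'v \<Rightarrow> 'g) \<Rightarrow> 'e set set" where
  "balanced_cycles \<Gamma> G \<sigma> =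
     {set es | vs es. traverses_cycle G vs es \<and> walk_gain \<Gamma> \<sigma> vs es = \<one>\<^bsub>\<Gamma>\<^esub>}"

definition frame_circuits ::
  "('g, 'm) monoid_scheme \<Rightarrow> ('v, 'e) graph \<Rightarrow> ('e \<Rightarrow> 'v \<Rightarrow> 'v \<Rightarrow> 'g) \<Rightarrow> 'e set set" where
  "frame_circuits \<Gamma> G \<sigma> = balanced_cycles \<Gamma> G \<sigma> \<union>
     {X \<in> bicycles G. \<not> (\<exists>C \<in> balanced_cycles \<Gamma> G \<sigma>. C \<subseteq> X)}"

text \<open>The frame matroid as the hypergraph of its independent sets, i.e. of the sets of edges
  containing no circuit. By a theorem of Zaslavsky this always is a matroid.\<close>

definition frame_matroid ::
  "('g, 'm) monoid_scheme \<Rightarrow> ('v, 'e) graph \<Rightarrow> ('e \<Rightarrow> 'v \<Rightarrow> 'v \<Rightarrow> 'g) \<Rightarrow> 'e hypergraph" where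
  "frame_matroid \<Gamma> G \<sigma> =
     (edges G, {X. X \<subseteq> edges G \<and> \<not> (\<exists>C \<in> frame_circuits \<Gamma> G \<sigma>. C \<subseteq> X)})"

text \<open>Graphs being finite, it is no restriction that their vertices are natural numbers.\<close>

definition gain_graphic_matroids :: "('g, 'm) monoid_scheme \<Rightarrow> 'e hypergraph set" where
  "gain_graphic_matroids \<Gamma> =
     {frame_matroid \<Gamma> G \<sigma> | (G :: (nat, 'e) graph) \<sigma>. is_graph G \<and> is_gaining \<Gamma> G \<sigma>}"

end

theory Submission
  imports Defs "HOL-Library.Countable"
begin

text \<open>A Myhill--Nerode argument. Since \<open>\<Gamma>\<close> is not uniformly locally finite, for a fixed
  bound on the number of generators there are geodesic words
  of every length, growing by one generator on the left at a time through the distinct elements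
  \<open>w\<^sub>0 = 1, w\<^sub>1, \<dots>, w\<^sub>N\<close>. On the vertices \<open>0, 1, 2\<close>
  put an unbalanced loop at every vertex, edges \<open>01\<close> with the gains of \<open>1\<close>, of the generators and
  of \<open>w\<^sub>i\<close>, and edges \<open>02\<close> and \<open>12\<close> with all gains \<open>w\<^sub>t\<close>; the balanced triangles spell out the
  multiplication table of the word. Put a second copy of the edges \<open>02\<close> and \<open>12\<close>, translated by a
  generic element of the infinite group, on the same vertices, so that no balanced cycle meets
  both copies. Amalgamating the left half for \<open>i\<close> with the right half for \<open>j\<close>
  gives a hypergraph that is gain-graphic for \<open>i = j\<close>. It is not for \<open>i \<noteq> j\<close>: lines with four points force the
  shape of the graph, the balanced triangles then force the edge of gain \<open>w\<^sub>i\<close> to equal both the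
  \<open>i\<close>-th and the \<open>j\<close>-th stage of one word, while the stages are pairwise distinct.
  Independence in the amalgam depends only on boundedly many types of subsets of the left half, so
  a sentence distinguishes only boundedly many left halves, independently of \<open>N\<close>.\<close>

section \<open>Independent sets of frame matroids\<close>

definition covered :: "('v, 'e) graph \<Rightarrow> 'e set \<Rightarrow> 'v set" where
  "covered G X = (\<Union>e \<in> X. ends G e)"

text \<open>Connectivity is argued with \<open>(adj G X)\<^sup>*\<close>, which is cut and joined
  more easily than walks given by two lists.\<close>

definition adj :: "('v, 'e) graph \<Rightarrow> 'e set \<Rightarrow> ('v \<times> 'v) set" where
  "adj G X = {(u, v). \<exists>e \<in> X. ends G e = {u, v}}"

lemma covered_mono: "X \<subseteq> Y \<Longrightarrow> covered G X \<subseteq> covered G Y"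
  by (auto simp: covered_def)

lemma adj_mono: "X \<subseteq> Y \<Longrightarrow> adj G X \<subseteq> adj G Y"
  by (auto simp: adj_def)

lemma adj_sym: "(u, v) \<in> adj G X \<Longrightarrow> (v, u) \<in> adj G X"
  by (auto simp: adj_def insert_commute)

lemma adj_rtrancl_sym: "(u, v) \<in> (adj G X)\<^sup>* \<Longrightarrow> (v, u) \<in> (adj G X)\<^sup>*"
  by (induction rule: rtrancl_induct) (auto intro: converse_rtrancl_into_rtrancl adj_sym)

lemma graph_ends:
  assumes "is_graph G" "e \<in> edges G"
  obtains u v where "ends G e = {u, v}"
  using assms unfolding is_graph_def by meson

lemma finite_covered:
  assumes "is_graph G" "X \<subseteq> edges G"
  shows "finite (covered G X)"
proof -
  have "finite X"
    using assms finite_subset unfolding is_graph_def by blast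
  moreover have "finite (ends G e)" if "e \<in> X" for e
    using that assms(2) by (metis assms(1) finite.emptyI finite_insert graph_ends subsetD)
  ultimately show ?thesis
    by (auto simp: covered_def)
qed

lemma finite_edge_set: "is_graph G \<Longrightarrow> X \<subseteq> edges G \<Longrightarrow> finite X"
  unfolding is_graph_def using finite_subset by blast

section \<open>Walks, paths and cycles in edge subgraphs\<close>

lemma is_walk_edge_subgraph_iff:
  "is_walk (edge_subgraph G X) vs es \<longleftrightarrow>
     length vs = Suc (length es) \<and> set vs \<subseteq> covered G X \<and>
     (\<forall>i < length es. es ! i \<in> X \<and> ends G (es ! i) = {vs ! i, vs ! Suc i})"
  by (simp add: is_walk_def edge_subgraph_def covered_def)

lemma traverses_cycle_mono:
  assumes "traverses_cycle (edge_subgraph G X) vs es" "X \<subseteq> Y"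
  shows "traverses_cycle (edge_subgraph G Y) vs es"
  using assms covered_mono[OF assms(2), of G]
  by (auto simp: traverses_cycle_def is_walk_edge_subgraph_iff)

lemma cycles_mono: "X \<subseteq> Y \<Longrightarrow> cycles (edge_subgraph G X) \<subseteq> cycles (edge_subgraph G Y)"
  by (auto simp: cycles_def dest: traverses_cycle_mono)

lemma cycles_subset: "C \<in> cycles (edge_subgraph G X) \<Longrightarrow> C \<subseteq> X"
  by (auto simp: cycles_def traverses_cycle_def is_walk_edge_subgraph_iff in_set_conv_nth)

lemma cycles_nonempty: "C \<in> cycles G \<Longrightarrow> C \<noteq> {}"
  by (auto simp: cycles_def traverses_cycle_def)

lemma walk_segment_reachable:
  assumes "i \<le> j" "\<And>k. i \<le> k \<Longrightarrow> k < j \<Longrightarrow> es ! k \<in> X \<and> ends G (es ! k) = {vs ! k, vs ! Suc k}"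
  shows "(vs ! i, vs ! j) \<in> (adj G X)\<^sup>*"
  using assms
proof (induction j rule: dec_induct)
  case base
  show ?case by simp
next
  case (step n)
  have "es ! n \<in> X \<and> ends G (es ! n) = {vs ! n, vs ! Suc n}"
    using step.hyps step.prems by simp
  then have "(vs ! n, vs ! Suc n) \<in> adj G X"
    by (auto simp: adj_def)
  moreover have "(vs ! i, vs ! n) \<in> (adj G X)\<^sup>*"
    using step by simp
  ultimately show ?case by auto
qed

text \<open>The path is grown edge by edge; when the new vertex was already visited, the path is cut
  back to that visit, which keeps its vertices distinct. The hypothesis on \<open>u\<close> is for
  the one-vertex path, whose vertex must belong to the edge subgraph.\<close>

lemma reachable_imp_path:
  assumes "(u, v) \<in> (adj G X)\<^sup>*" "u \<in> covered G X"
  shows "\<exists>vs es. is_walk (edge_subgraph G X) vs es \<and> hd vs = u \<and> last vs = v \<and> distinct vs"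
  using assms(1)
proof (induction rule: rtrancl_induct)
  case base
  have "is_walk (edge_subgraph G X) [u] []"
    using assms(2) by (simp add: is_walk_edge_subgraph_iff)
  then show ?case by force
next
  case (step y z)
  then obtain vs es where w: "is_walk (edge_subgraph G X) vs es" "hd vs = u" "last vs = y" "distinct vs"
    by blast
  obtain e where e: "e \<in> X" "ends G e = {y, z}"
    using step.hyps by (auto simp: adj_def)
  have len: "length vs = Suc (length es)"
    using w(1) by (simp add: is_walk_edge_subgraph_iff)
  then have "vs \<noteq> []" by auto
  show ?case
  proof (cases "z \<in> set vs")
    case True
    then obtain k where k: "k < length vs" "vs ! k = z"
      by (auto simp: in_set_conv_nth)
    have "is_walk (edge_subgraph G X) (take (Suc k) vs) (take k es)"
      using w(1) k(1) len by (auto simp: is_walk_edge_subgraph_iff dest: in_set_takeD)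
    moreover have "hd (take (Suc k) vs) = u" "last (take (Suc k) vs) = z"
      using w(2) k \<open>vs \<noteq> []\<close> by (simp_all add: last_conv_nth)
    ultimately show ?thesis
      using w(4) distinct_take by blast
  next
    case False
    have "z \<in> covered G X"
      using e by (auto simp: covered_def)
    moreover have "vs ! length es = y"
      using w(3) len \<open>vs \<noteq> []\<close> by (simp add: last_conv_nth)
    ultimately have "is_walk (edge_subgraph G X) (vs @ [z]) (es @ [e])"
      using w(1) e len
      by (auto simp: is_walk_edge_subgraph_iff nth_append less_Suc_eq)
    moreover have "hd (vs @ [z]) = u" "last (vs @ [z]) = z" "distinct (vs @ [z])"
      using w(2,4) False \<open>vs \<noteq> []\<close> by auto
    ultimately show ?thesis by blast
  qed
qed

text \<open>An edge used at positions i < j would put \<open>vs ! i\<close> among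
  \<open>vs ! j\<close> and \<open>vs ! Suc j\<close>.\<close>

lemma path_edges_distinct:
  assumes "is_walk G vs es" "distinct vs"
  shows "distinct es"
proof -
  have *: "False" if "i < j" "j < length es" "es ! i = es ! j" for i j
  proof -
    have "ends G (es ! i) = {vs ! i, vs ! Suc i}" "ends G (es ! j) = {vs ! j, vs ! Suc j}"
      using assms(1) that(1,2) by (auto simp: is_walk_def dest: order.strict_trans)
    then have "vs ! i \<in> {vs ! j, vs ! Suc j}"
      using that(3) by (metis insertI1)
    then show False
      using that assms nth_eq_iff_index_eq[OF assms(2)] by (auto simp: is_walk_def)
  qed
  then show ?thesis
    unfolding distinct_conv_nth by (metis linorder_neqE_nat)
qed

text \<open>For \<open>u = v\<close> distinctness leaves only the one-vertex path, and the cycle is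
  the loop \<open>e\<close>.\<close>

lemma path_plus_edge_cycle:
  assumes "is_walk (edge_subgraph G X) vs es" "distinct vs" "hd vs = u" "last vs = v"
    and "ends G e = {u, v}" "e \<notin> X"
  shows "set (es @ [e]) \<in> cycles (edge_subgraph G (insert e X))"
proof -
  have len: "length vs = Suc (length es)" and ne: "vs \<noteq> []"
    using assms(1) by (auto simp: is_walk_edge_subgraph_iff)
  have *: "vs ! length es = v" "vs ! 0 = u"
    using assms(3,4) len ne by (auto simp: last_conv_nth hd_conv_nth)
  have "is_walk (edge_subgraph G (insert e X)) (vs @ [u]) (es @ [e])"
    using assms(1,5) len * covered_mono[of X "insert e X" G]
    by (auto simp: is_walk_edge_subgraph_iff nth_append less_Suc_eq insert_commute) (auto simp: covered_def)
  moreover have "distinct (tl (vs @ [u]))"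
    using assms(2,3) ne by (cases vs) auto
  moreover have "distinct (es @ [e])"
    using path_edges_distinct[OF assms(1,2)] assms(1,6)
    by (auto simp: is_walk_edge_subgraph_iff in_set_conv_nth)
  moreover have "hd (vs @ [u]) = last (vs @ [u])"
    using assms(3) ne by auto
  ultimately show ?thesis
    unfolding cycles_def traverses_cycle_def by blast
qed

text \<open>In the next two lemmas \<open>\<kappa>\<close> names the components of the graph with vertex set \<open>V\<close>
  and edge set \<open>X\<close>; merging two components along an edge loses at most one name.\<close>

lemma component_bound:
  fixes G :: "('v, 'e) graph"
  assumes "finite X" "finite V" "\<And>e. e \<in> X \<Longrightarrow> \<exists>u \<in> V. \<exists>v \<in> V. ends G e = {u, v}"
  shows "\<exists>\<kappa> :: 'v \<Rightarrow> 'v. (\<forall>(u, v) \<in> adj G X. \<kappa> u = \<kappa> v) \<and> card V \<le> card X + card (\<kappa> ` V)"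
  using assms(1,3)
proof (induction rule: finite_induct)
  case empty
  show ?case by (rule exI[of _ "\<lambda>x. x"]) (simp add: adj_def)
next
  case (insert e X)
  then obtain \<kappa> :: "'v \<Rightarrow> 'v" where \<kappa>: "\<forall>(u, v) \<in> adj G X. \<kappa> u = \<kappa> v"
    "card V \<le> card X + card (\<kappa> ` V)"
    by auto
  obtain u v where uv: "u \<in> V" "v \<in> V" "ends G e = {u, v}"
    using insert.prems[OF insertI1] by blast
  define \<kappa>' where "\<kappa>' = (\<lambda>x. if \<kappa> x = \<kappa> v then \<kappa> u else \<kappa> x)"
  have "\<kappa> ` V \<subseteq> insert (\<kappa> v) (\<kappa>' ` V)"
    by (auto simp: \<kappa>'_def)
  then have "card (\<kappa> ` V) \<le> card (insert (\<kappa> v) (\<kappa>' ` V))"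
    using assms(2) by (intro card_mono) auto
  also have "\<dots> \<le> Suc (card (\<kappa>' ` V))"
    using assms(2) by (simp add: card_insert_if)
  finally have "card (\<kappa> ` V) \<le> Suc (card (\<kappa>' ` V))" .
  moreover have "\<forall>(x, y) \<in> adj G (insert e X). \<kappa>' x = \<kappa>' y"
    using \<kappa>(1) uv(3) by (auto simp: adj_def \<kappa>'_def doubleton_eq_iff)
  ultimately show ?case
    using \<kappa>(2) insert.hyps by (intro exI[of _ \<kappa>']) auto
qed

lemma acyclic_component_count:
  fixes G :: "('v, 'e) graph"
  assumes "finite X" "finite V" "\<And>e. e \<in> X \<Longrightarrow> \<exists>u \<in> V. \<exists>v \<in> V. ends G e = {u, v}"
    and "cycles (edge_subgraph G X) = {}"
  shows "\<exists>\<kappa> :: 'v \<Rightarrow> 'v. (\<forall>u \<in> V. \<forall>v \<in> V. \<kappa> u = \<kappa> v \<longrightarrow> (u, v) \<in> (adj G X)\<^sup>*) \<and>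
           card X + card (\<kappa> ` V) \<le> card V"
  using assms(1,3,4)
proof (induction rule: finite_induct)
  case empty
  show ?case by (rule exI[of _ "\<lambda>x. x"]) auto
next
  case (insert e X)
  have "cycles (edge_subgraph G X) = {}"
    using insert.prems(2) cycles_mono[of X "insert e X" G] by blast
  then obtain \<kappa> :: "'v \<Rightarrow> 'v"
    where \<kappa>_all: "\<forall>u \<in> V. \<forall>v \<in> V. \<kappa> u = \<kappa> v \<longrightarrow> (u, v) \<in> (adj G X)\<^sup>*"
      and card_\<kappa>: "card X + card (\<kappa> ` V) \<le> card V"
    using insert.IH[OF insert.prems(1)[OF insertI2]] by blast
  have \<kappa>: "(u, v) \<in> (adj G X)\<^sup>*" if "u \<in> V" "v \<in> V" "\<kappa> u = \<kappa> v" for u v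
    using \<kappa>_all that by blast
  obtain u v where uv: "u \<in> V" "v \<in> V" "ends G e = {u, v}"
    using insert.prems(1)[OF insertI1] by blast
  \<comment> \<open>If the ends of \<open>e\<close> carried the same name, a path in
    \<open>X\<close> would join them and \<open>e\<close> would close it to a cycle.\<close>
  have ne: "\<kappa> u \<noteq> \<kappa> v"
  proof
    assume "\<kappa> u = \<kappa> v"
    then have r: "(u, v) \<in> (adj G X)\<^sup>*" using \<kappa> uv by blast
    show False
    proof (cases "u = v")
      \<comment> \<open>A loop is handled apart: \<open>u\<close> need not be covered by
        \<open>X\<close>, and then it starts no walk in the edge subgraph.\<close>
      case True
      then have "traverses_cycle (edge_subgraph G (insert e X)) [u, u] [e]"
        using uv by (auto simp: traverses_cycle_def is_walk_edge_subgraph_iff covered_def)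
      then show False using insert.prems(2) unfolding cycles_def by blast
    next
      case False
      then obtain y where "(u, y) \<in> adj G X"
        using r by (meson converse_rtranclE)
      then have "u \<in> covered G X" by (auto simp: adj_def covered_def)
      with reachable_imp_path[OF r] path_plus_edge_cycle[OF _ _ _ _ uv(3)] insert.hyps(2) insert.prems(2)
      show False by blast
    qed
  qed
  define \<kappa>' where "\<kappa>' = (\<lambda>x. if \<kappa> x = \<kappa> v then \<kappa> u else \<kappa> x)"
  have sub: "(adj G X)\<^sup>* \<subseteq> (adj G (insert e X))\<^sup>*"
    by (intro rtrancl_mono adj_mono) auto
  have \<kappa>_new: "(x, y) \<in> (adj G (insert e X))\<^sup>*" if "x \<in> V" "y \<in> V" "\<kappa> x = \<kappa> y" for x y
    using \<kappa> that sub by blast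
  have e_new: "(u, v) \<in> (adj G (insert e X))\<^sup>*"
    using uv(3) by (auto simp: adj_def)
  have merged: "(x, u) \<in> (adj G (insert e X))\<^sup>*" if "x \<in> V" "\<kappa>' x = \<kappa> u" for x
  proof (cases "\<kappa> x = \<kappa> v")
    case True
    then show ?thesis
      using \<kappa>_new[OF that(1) uv(2)] adj_rtrancl_sym[OF e_new] by (blast intro: rtrancl_trans)
  next
    case False
    then show ?thesis
      using \<kappa>_new[OF that(1) uv(1)] that(2) by (simp add: \<kappa>'_def)
  qed
  have "(x, y) \<in> (adj G (insert e X))\<^sup>*" if "x \<in> V" "y \<in> V" "\<kappa>' x = \<kappa>' y" for x y
  proof (cases "\<kappa>' x = \<kappa> u")
    case True
    then show ?thesis
      using merged[of x] merged[of y] adj_rtrancl_sym that by (metis rtrancl_trans)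
  next
    case False
    then show ?thesis
      using \<kappa>_new that by (auto simp: \<kappa>'_def split: if_splits)
  qed
  \<comment> \<open>By \<open>ne\<close> the name \<open>\<kappa> v\<close> is lost, which pays for
    the added edge.\<close>
  moreover have "\<kappa>' ` V \<subseteq> \<kappa> ` V - {\<kappa> v}"
    using ne uv by (auto simp: \<kappa>'_def)
  then have "card (\<kappa>' ` V) < card (\<kappa> ` V)"
    using assms(2) uv(2) by (intro psubset_card_mono) auto
  ultimately show ?case
    using card_\<kappa> insert.hyps by (intro exI[of _ \<kappa>']) auto
qed

section \<open>Cycles and bicycles from counting edges and vertices\<close>

lemma ends_in_covered:
  assumes "is_graph G" "X \<subseteq> edges G" "e \<in> X"
  shows "\<exists>u \<in> covered G X. \<exists>v \<in> covered G X. ends G e = {u, v}"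
proof -
  obtain u v where "ends G e = {u, v}"
    using assms graph_ends by (metis subsetD)
  moreover from this have "{u, v} \<subseteq> covered G X"
    using assms(3) unfolding covered_def by (metis UN_upper)
  ultimately show ?thesis by auto
qed

lemma covered_nonempty:
  assumes "is_graph G" "X \<subseteq> edges G" "X \<noteq> {}"
  shows "covered G X \<noteq> {}"
  using assms(3) ends_in_covered[OF assms(1,2)] by blast

text \<open>A forest on a nonempty vertex set has fewer edges than vertices, since at least one
  component name is left.\<close>

lemma contains_cycle:
  assumes "is_graph G" "X \<subseteq> edges G" "X \<noteq> {}" "card (covered G X) \<le> card X"
  shows "cycles (edge_subgraph G X) \<noteq> {}"
proof
  assume "cycles (edge_subgraph G X) = {}"
  then obtain \<kappa> :: "'a \<Rightarrow> 'a" where "card X + card (\<kappa> ` covered G X) \<le> card (covered G X)"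
    using acyclic_component_count[OF finite_edge_set[OF assms(1,2)] finite_covered[OF assms(1,2)]
        ends_in_covered[OF assms(1,2)]] by blast
  moreover have "card (\<kappa> ` covered G X) > 0"
    using finite_covered[OF assms(1,2)] covered_nonempty[OF assms(1-3)] by (simp add: card_gt_0_iff)
  ultimately show False using assms(4) by linarith
qed

text \<open>Whatever uses \<open>e\<close> can go round the rest of the cycle instead.\<close>

lemma cycle_edge_redundant:
  assumes "C \<in> cycles (edge_subgraph G X)" "e \<in> C"
  shows "(adj G X)\<^sup>* \<subseteq> (adj G (X - {e}))\<^sup>*"
proof -
  obtain vs es where t: "traverses_cycle (edge_subgraph G X) vs es" "set es = C"
    using assms(1) by (auto simp: cycles_def)
  obtain i where i: "i < length es" "es ! i = e"
    using assms(2) t(2) by (auto simp: in_set_conv_nth)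
  have w: "length vs = Suc (length es)" "distinct es" "hd vs = last vs"
    "\<And>k. k < length es \<Longrightarrow> es ! k \<in> X \<and> ends G (es ! k) = {vs ! k, vs ! Suc k}"
    using t(1) by (auto simp: traverses_cycle_def is_walk_edge_subgraph_iff)
  have other: "es ! k \<in> X - {e} \<and> ends G (es ! k) = {vs ! k, vs ! Suc k}"
    if "k < length es" "k \<noteq> i" for k
    using w(2) w(4)[OF that(1)] i that by (auto simp: nth_eq_iff_index_eq)
  \<comment> \<open>Without \<open>e\<close> the cycle falls into two segments that meet at
    \<open>vs ! 0\<close>, which is also its last vertex; together they join the ends of
    \<open>e\<close>.\<close>
  have "(vs ! 0, vs ! i) \<in> (adj G (X - {e}))\<^sup>*"
    by (rule walk_segment_reachable[where es = es]) (use other i in auto)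
  moreover have "(vs ! Suc i, vs ! length es) \<in> (adj G (X - {e}))\<^sup>*"
    by (rule walk_segment_reachable[where es = es]) (use other i in auto)
  moreover have "vs ! length es = vs ! 0"
    using w(1,3) by (metis diff_Suc_1 hd_conv_nth last_conv_nth length_0_conv nat.distinct(1))
  ultimately have r: "(vs ! Suc i, vs ! i) \<in> (adj G (X - {e}))\<^sup>*"
    by (metis rtrancl_trans)
  have "adj G X \<subseteq> (adj G (X - {e}))\<^sup>*"
  proof clarify
    fix u v assume "(u, v) \<in> adj G X"
    then obtain f where f: "f \<in> X" "ends G f = {u, v}"
      by (auto simp: adj_def)
    show "(u, v) \<in> (adj G (X - {e}))\<^sup>*"
    proof (cases "f = e")
      case True
      then have "(u = vs ! i \<and> v = vs ! Suc i) \<or> (u = vs ! Suc i \<and> v = vs ! i)"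
        using f(2) w(4)[OF i(1)] i(2) by (auto simp: doubleton_eq_iff)
      then show ?thesis using r adj_rtrancl_sym[OF r] by blast
    next
      case False
      then have "(u, v) \<in> adj G (X - {e})"
        using f by (auto simp: adj_def)
      then show ?thesis by blast
    qed
  qed
  then show ?thesis
    by (rule rtrancl_subset_rtrancl)
qed

lemma connected_edge_subgraph_iff:
  "connected_graph (edge_subgraph G X) \<longleftrightarrow>
     (\<forall>u \<in> covered G X. \<forall>v \<in> covered G X. (u, v) \<in> (adj G X)\<^sup>*)"
proof -
  have "(\<exists>vs es. is_walk (edge_subgraph G X) vs es \<and> hd vs = u \<and> last vs = v) \<longleftrightarrow>
          (u, v) \<in> (adj G X)\<^sup>*" if "u \<in> covered G X" for u v
  proof
    assume "\<exists>vs es. is_walk (edge_subgraph G X) vs es \<and> hd vs = u \<and> last vs = v"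
    then obtain vs es where w: "is_walk (edge_subgraph G X) vs es" "hd vs = u" "last vs = v"
      by blast
    then have len: "length vs = Suc (length es)"
      by (simp add: is_walk_edge_subgraph_iff)
    have "(vs ! 0, vs ! length es) \<in> (adj G X)\<^sup>*"
      by (rule walk_segment_reachable[where es = es]) (use w in \<open>auto simp: is_walk_edge_subgraph_iff\<close>)
    moreover have "vs \<noteq> []"
      using len by auto
    then have "vs ! 0 = u" "vs ! length es = v"
      using w(2,3) len by (auto simp: last_conv_nth hd_conv_nth)
    ultimately show "(u, v) \<in> (adj G X)\<^sup>*" by simp
  next
    assume "(u, v) \<in> (adj G X)\<^sup>*"
    then show "\<exists>vs es. is_walk (edge_subgraph G X) vs es \<and> hd vs = u \<and> last vs = v"
      using reachable_imp_path that by metis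
  qed
  then show ?thesis
    by (auto simp: connected_graph_def edge_subgraph_def covered_def[symmetric])
qed

text \<open>Delete an edge \<open>e\<close> of one cycle that is not in another cycle
  \<open>D\<close>, then an edge \<open>f\<close> of \<open>D\<close>. Connectivity survives both
  deletions, and a connected graph has at most one vertex more than it has edges.\<close>

lemma connected_two_cycles_imp_overfull:
  assumes "is_graph G" "X \<subseteq> edges G" "connected_two_cycles G X"
  shows "card (covered G X) < card X"
proof -
  obtain C D e where CD: "C \<in> cycles (edge_subgraph G X)" "D \<in> cycles (edge_subgraph G X)"
    "e \<in> C" "e \<notin> D"
    using assms(3) unfolding connected_two_cycles_def by blast
  obtain f where f: "f \<in> D"
    using CD(2) cycles_nonempty by blast
  have D': "D \<in> cycles (edge_subgraph G (X - {e}))"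
  proof -
    obtain vs es where t: "traverses_cycle (edge_subgraph G X) vs es" "set es = D"
      using CD(2) by (auto simp: cycles_def)
    then have len: "length vs = Suc (length es)" and "es \<noteq> []"
      by (auto simp: traverses_cycle_def is_walk_edge_subgraph_iff)
    have es: "es ! k \<in> X - {e} \<and> ends G (es ! k) = {vs ! k, vs ! Suc k}" if "k < length es" for k
      using t that CD(4) by (auto simp: traverses_cycle_def is_walk_edge_subgraph_iff)
    \<comment> \<open>The vertex set of an edge subgraph shrinks with its edges, so each vertex of
      \<open>D\<close> has to be found on a surviving edge.\<close>
    have "vs ! k \<in> covered G (X - {e})" if "k < length vs" for k
    proof (cases k)
      case 0
      then show ?thesis using es[of 0] \<open>es \<noteq> []\<close> by (auto simp: covered_def intro!: bexI[of _ "es ! 0"])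
    next
      case (Suc l)
      then show ?thesis using es[of l] that len by (auto simp: covered_def intro!: bexI[of _ "es ! l"])
    qed
    then have "set vs \<subseteq> covered G (X - {e})"
      by (auto simp: in_set_conv_nth)
    then have "traverses_cycle (edge_subgraph G (X - {e})) vs es"
      using t(1) es len by (auto simp: traverses_cycle_def is_walk_edge_subgraph_iff)
    then show ?thesis
      using t(2) by (auto simp: cycles_def)
  qed
  have ef: "e \<in> X" "f \<in> X" "e \<noteq> f"
    using CD f cycles_subset by blast+
  let ?V = "covered G X" and ?Y = "X - {e} - {f}"
  have fin: "finite X" "finite ?V"
    using finite_edge_set finite_covered assms by auto
  have "\<exists>u \<in> ?V. \<exists>v \<in> ?V. ends G g = {u, v}" if "g \<in> ?Y" for g
    using ends_in_covered[OF assms(1,2)] that by simp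
  then obtain \<kappa> :: "'a \<Rightarrow> 'a" where \<kappa>: "\<forall>(u, v) \<in> adj G ?Y. \<kappa> u = \<kappa> v"
    "card ?V \<le> card ?Y + card (\<kappa> ` ?V)"
    using component_bound[of ?Y ?V G] fin by auto
  have \<kappa>_const: "(u, v) \<in> (adj G ?Y)\<^sup>* \<Longrightarrow> \<kappa> u = \<kappa> v" for u v
    by (induction rule: rtrancl_induct) (use \<kappa>(1) in auto)
  have "\<kappa> u = \<kappa> v" if "u \<in> ?V" "v \<in> ?V" for u v
  proof -
    have "(u, v) \<in> (adj G X)\<^sup>*"
      using assms(3) that by (simp add: connected_two_cycles_def connected_edge_subgraph_iff)
    then show ?thesis
      using cycle_edge_redundant[OF CD(1,3)] cycle_edge_redundant[OF D' f] \<kappa>_const by blast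
  qed
  then have "\<forall>a \<in> \<kappa> ` ?V. \<forall>b \<in> \<kappa> ` ?V. a = b"
    by blast
  then have "card (\<kappa> ` ?V) \<le> Suc 0"
    using card_le_Suc0_iff_eq[of "\<kappa> ` ?V"] fin(2) by blast
  moreover have "card ?Y = card X - 2" "card X \<ge> 2"
    using ef fin(1) card_mono[of X "{e, f}"] by (auto simp: card_Diff_singleton_if)
  ultimately show ?thesis
    using \<kappa>(2) by linarith
qed

text \<open>Counting yields a cycle, and deleting one of its edges leaves enough edges for a second
  one. If \<open>X\<close> were disconnected, the bounds from \<open>minimal\<close> for its two
  parts would add up to a bound for \<open>X\<close>.\<close>

lemma minimal_overfull_connected_two_cycles:
  assumes "is_graph G" "X \<subseteq> edges G" "card (covered G X) < card X"
    and minimal: "\<And>Y. Y \<subset> X \<Longrightarrow> card Y \<le> card (covered G Y)"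
  shows "connected_two_cycles G X"
proof -
  have fin: "finite X" using assms finite_edge_set by auto
  have "X \<noteq> {}" using assms(3) by auto
  obtain C where C: "C \<in> cycles (edge_subgraph G X)"
    using contains_cycle[OF assms(1,2) \<open>X \<noteq> {}\<close>] assms(3) by auto
  obtain e where e: "e \<in> C" "e \<in> X"
    using C cycles_nonempty cycles_subset by blast
  have "card (covered G X) > 0"
    using covered_nonempty[OF assms(1,2) \<open>X \<noteq> {}\<close>] finite_covered[OF assms(1,2)]
    by (simp add: card_gt_0_iff)
  then have "card (X - {e}) \<noteq> 0"
    using assms(3) e(2) fin by simp
  then have "X - {e} \<noteq> {}"
    by (metis card.empty)
  moreover have "card (covered G (X - {e})) \<le> card (X - {e})"
    using card_mono[OF finite_covered[OF assms(1,2)] covered_mono[of "X - {e}" X G]] assms(3) e(2) fin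
    by auto
  ultimately obtain D where D: "D \<in> cycles (edge_subgraph G (X - {e}))"
    using contains_cycle[OF assms(1), of "X - {e}"] assms(2) by blast
  have "D \<in> cycles (edge_subgraph G X)" "C \<noteq> D"
    using D cycles_mono[of "X - {e}" X G] cycles_subset[OF D] e(1) by blast+
  moreover have "(u, v) \<in> (adj G X)\<^sup>*" if u: "u \<in> covered G X" and v: "v \<in> covered G X" for u v
  proof (rule ccontr)
    assume uv: "(u, v) \<notin> (adj G X)\<^sup>*"
    \<comment> \<open>\<open>U\<close> is the component of \<open>u\<close>; every edge of
      \<open>X\<close> lies inside it or misses it.\<close>
    define U where "U = {x. (u, x) \<in> (adj G X)\<^sup>*}"
    define Y where "Y = {e \<in> X. ends G e \<subseteq> U}"
    have split: "ends G e \<subseteq> U \<or> ends G e \<inter> U = {}" if eX: "e \<in> X" for e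
    proof -
      obtain x y where xy: "ends G e = {x, y}"
        using graph_ends assms(1,2) eX by (metis subsetD)
      then have "(x, y) \<in> adj G X" "(y, x) \<in> adj G X"
        using eX by (auto simp: adj_def insert_commute)
      then show ?thesis
        unfolding xy U_def by (auto intro: rtrancl_into_rtrancl)
    qed
    have nonempty: "ends G e \<noteq> {}" if "e \<in> X" for e
      using graph_ends assms(1,2) that by (metis insert_not_empty subsetD)
    have "u \<in> U" "v \<notin> U" by (simp_all add: U_def uv)
    then have "Y \<subset> X" "X - Y \<subset> X"
      using u v split nonempty by (auto simp: Y_def covered_def) blast+
    then have "card Y \<le> card (covered G Y)" "card (X - Y) \<le> card (covered G (X - Y))"
      using minimal by blast+
    moreover have "card Y + card (X - Y) = card X"
      using card_Int_Diff[OF fin, of Y] \<open>Y \<subset> X\<close> by (simp add: Int_absorb1 psubset_imp_subset)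
    moreover have "covered G Y \<inter> covered G (X - Y) = {}"
      using split by (auto simp: covered_def Y_def)
    moreover have cov: "covered G Y \<union> covered G (X - Y) = covered G X"
      using \<open>Y \<subset> X\<close> by (auto simp: covered_def)
    ultimately have "card X \<le> card (covered G X)"
      using finite_covered[OF assms(1,2)] card_Un_disjoint[of "covered G Y" "covered G (X - Y)"]
      unfolding cov[symmetric] by simp
    then show False using assms(3) by simp
  qed
  ultimately show ?thesis
    using C unfolding connected_two_cycles_def connected_edge_subgraph_iff by blast
qed

text \<open>Two minimisations: first of \<open>card (covered G Y) < card Y\<close>, which produces a
  connected subset with two cycles, then of \<open>connected_two_cycles\<close> itself.\<close>

lemma contains_bicycle:
  assumes "is_graph G" "X \<subseteq> edges G" "card (covered G X) < card X"
  shows "\<exists>B \<in> bicycles G. B \<subseteq> X"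
proof -
  have fin: "finite X" using assms finite_edge_set by auto
  have "\<exists>Y. Y \<subseteq> X \<and> connected_two_cycles G Y"
    using fin assms(2,3)
  proof (induction X rule: finite_psubset_induct)
    case (psubset X)
    show ?case
    proof (cases "\<exists>Y. Y \<subset> X \<and> card (covered G Y) < card Y")
      case True
      then obtain Y where Y: "Y \<subset> X" "card (covered G Y) < card Y" by blast
      then have "Y \<subseteq> edges G" using psubset.prems(1) by blast
      then show ?thesis
        using psubset.IH[OF Y(1) _ Y(2)] Y(1) by blast
    next
      case False
      then have "connected_two_cycles G X"
        using minimal_overfull_connected_two_cycles[OF assms(1) psubset.prems] by (meson not_less)
      then show ?thesis by blast
    qed
  qed
  then obtain B where B: "B \<subseteq> X" "connected_two_cycles G B"
    and min: "\<And>Y. Y \<subset> B \<Longrightarrow> \<not> connected_two_cycles G Y"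
  proof -
    assume *: "\<exists>Y. Y \<subseteq> X \<and> connected_two_cycles G Y"
      and r: "\<And>B. B \<subseteq> X \<Longrightarrow> connected_two_cycles G B \<Longrightarrow>
                (\<And>Y. Y \<subset> B \<Longrightarrow> \<not> connected_two_cycles G Y) \<Longrightarrow> thesis"
    have "finite {Y. Y \<subseteq> X \<and> connected_two_cycles G Y}" using fin by simp
    with * obtain B where "B \<in> {Y. Y \<subseteq> X \<and> connected_two_cycles G Y}"
      "\<forall>Y \<in> {Y. Y \<subseteq> X \<and> connected_two_cycles G Y}. Y \<subseteq> B \<longrightarrow> B = Y"
      using finite_has_minimal[of "{Y. Y \<subseteq> X \<and> connected_two_cycles G Y}"] by blast
    then show thesis using r[of B] by blast
  qed
  then show ?thesis
    using assms(2) unfolding bicycles_def by blast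
qed

text \<open>Bicycles are overfull and overfull sets contain bicycles, so bicycles can be traded for
  an inequality between edges and covered vertices. From here on independence in frame matroids is
  handled through this criterion.\<close>

lemma frame_independent_iff:
  assumes "is_graph G"
  shows "X \<in> snd (frame_matroid \<Gamma> G \<sigma>) \<longleftrightarrow>
    X \<subseteq> edges G \<and> (\<forall>C \<in> balanced_cycles \<Gamma> G \<sigma>. \<not> C \<subseteq> X) \<and>
    (\<forall>Y \<subseteq> X. card Y \<le> card (covered G Y))"
proof (cases "X \<subseteq> edges G")
  case True
  have circuit: "\<exists>C \<in> frame_circuits \<Gamma> G \<sigma>. C \<subseteq> X" if Y: "Y \<subseteq> X" "card (covered G Y) < card Y" for Y
  proof -
    obtain B where "B \<in> bicycles G" "B \<subseteq> Y"
      using contains_bicycle[OF assms _ Y(2)] True Y(1) by blast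
    \<comment> \<open>The bicycle is itself a circuit unless it contains a balanced cycle, and then
      that cycle is a circuit.\<close>
    then show ?thesis
      using Y(1) unfolding frame_circuits_def by (cases "\<exists>C \<in> balanced_cycles \<Gamma> G \<sigma>. C \<subseteq> B") blast+
  qed
  have overfull: "card (covered G B) < card B" if "B \<in> bicycles G" for B
    using connected_two_cycles_imp_overfull[OF assms] that by (simp add: bicycles_def)
  have "(\<exists>C \<in> frame_circuits \<Gamma> G \<sigma>. C \<subseteq> X) \<longleftrightarrow>
      (\<exists>C \<in> balanced_cycles \<Gamma> G \<sigma>. C \<subseteq> X) \<or> (\<exists>Y \<subseteq> X. card (covered G Y) < card Y)"
    (is "?L \<longleftrightarrow> ?R")
  proof
    assume ?L
    then obtain C where "C \<in> balanced_cycles \<Gamma> G \<sigma> \<or> C \<in> bicycles G" "C \<subseteq> X"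
      by (auto simp: frame_circuits_def)
    then show ?R using overfull[of C] by metis
  next
    assume ?R
    then show ?L
    proof
      assume "\<exists>C \<in> balanced_cycles \<Gamma> G \<sigma>. C \<subseteq> X"
      then show ?L by (auto simp: frame_circuits_def)
    next
      assume "\<exists>Y \<subseteq> X. card (covered G Y) < card Y"
      then show ?L using circuit by metis
    qed
  qed
  then show ?thesis
    using True by (auto simp: frame_matroid_def not_less)
qed (simp add: frame_matroid_def)

section \<open>Short balanced cycles and long lines\<close>

lemma gaining_carrier:
  assumes "is_gaining \<Gamma> G \<sigma>" "e \<in> edges G" "ends G e = {u, v}"
  shows "\<sigma> e u v \<in> carrier \<Gamma>" "\<sigma> e v u \<in> carrier \<Gamma>"
  using assms unfolding is_gaining_def by (auto simp: insert_commute)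

lemma gaining_reverse:
  assumes "is_gaining \<Gamma> G \<sigma>" "e \<in> edges G" "ends G e = {u, v}" "u \<noteq> v"
  shows "\<sigma> e v u = inv\<^bsub>\<Gamma>\<^esub> (\<sigma> e u v)"
  using assms unfolding is_gaining_def by (metis insert_commute)

lemma graph_ends_verts:
  "is_graph G \<Longrightarrow> e \<in> edges G \<Longrightarrow> ends G e = {u, v} \<Longrightarrow> u \<in> verts G \<and> v \<in> verts G"
  unfolding is_graph_def by (metis doubleton_eq_iff)

text \<open>Only cycles with at most three edges are ever examined; unrolling their walks turns
  balance into an explicit equation between gains.\<close>

lemma balanced_cycle_card_le_3:
  assumes "group \<Gamma>" "is_gaining \<Gamma> G \<sigma>" "C \<in> balanced_cycles \<Gamma> G \<sigma>" "card C \<le> 3"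
  shows "C \<subseteq> edges G" and
    "(\<exists>u e. C = {e} \<and> ends G e = {u} \<and> \<sigma> e u u = \<one>\<^bsub>\<Gamma>\<^esub>) \<or>
     (\<exists>u v e f. C = {e, f} \<and> e \<noteq> f \<and> u \<noteq> v \<and> ends G e = {u, v} \<and> ends G f = {u, v} \<and>
        \<sigma> e u v \<otimes>\<^bsub>\<Gamma>\<^esub> \<sigma> f v u = \<one>\<^bsub>\<Gamma>\<^esub>) \<or>
     (\<exists>u v x e f g. C = {e, f, g} \<and> distinct [u, v, x] \<and> distinct [e, f, g] \<and>
        ends G e = {u, v} \<and> ends G f = {v, x} \<and> ends G g = {x, u} \<and>
        \<sigma> e u v \<otimes>\<^bsub>\<Gamma>\<^esub> (\<sigma> f v x \<otimes>\<^bsub>\<Gamma>\<^esub> \<sigma> g x u) = \<one>\<^bsub>\<Gamma>\<^esub>)"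
proof -
  interpret group \<Gamma> by fact
  obtain vs es where t: "C = set es" "traverses_cycle G vs es" "walk_gain \<Gamma> \<sigma> vs es = \<one>\<^bsub>\<Gamma>\<^esub>"
    using assms(3) unfolding balanced_cycles_def by blast
  have w: "length vs = Suc (length es)" "distinct (tl vs)" "distinct es" "hd vs = last vs" "es \<noteq> []"
    "\<And>i. i < length es \<Longrightarrow> es ! i \<in> edges G \<and> ends G (es ! i) = {vs ! i, vs ! Suc i}"
    using t(2) by (auto simp: traverses_cycle_def is_walk_def)
  show "C \<subseteq> edges G"
    using w(6) t(1) by (auto simp: in_set_conv_nth)
  have "length es = card C" using t(1) w(3) by (simp add: distinct_card)
  then have "length es = 1 \<or> length es = 2 \<or> length es = 3"
    using assms(4) w(5) by (cases "length es") auto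
  then show "(\<exists>u e. C = {e} \<and> ends G e = {u} \<and> \<sigma> e u u = \<one>\<^bsub>\<Gamma>\<^esub>) \<or>
     (\<exists>u v e f. C = {e, f} \<and> e \<noteq> f \<and> u \<noteq> v \<and> ends G e = {u, v} \<and> ends G f = {u, v} \<and>
        \<sigma> e u v \<otimes>\<^bsub>\<Gamma>\<^esub> \<sigma> f v u = \<one>\<^bsub>\<Gamma>\<^esub>) \<or>
     (\<exists>u v x e f g. C = {e, f, g} \<and> distinct [u, v, x] \<and> distinct [e, f, g] \<and>
        ends G e = {u, v} \<and> ends G f = {v, x} \<and> ends G g = {x, u} \<and>
        \<sigma> e u v \<otimes>\<^bsub>\<Gamma>\<^esub> (\<sigma> f v x \<otimes>\<^bsub>\<Gamma>\<^esub> \<sigma> g x u) = \<one>\<^bsub>\<Gamma>\<^esub>)"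
  proof (elim disjE)
    assume "length es = 1"
    then obtain e u v where es: "es = [e]" "vs = [u, v]"
      using w(1) by (auto simp: length_Suc_conv)
    then have "v = u" "e \<in> edges G" "ends G e = {u}"
      using w(4) w(6)[of 0] by auto
    moreover have "\<sigma> e u u = \<one>\<^bsub>\<Gamma>\<^esub>"
      using t(3) es calculation gaining_carrier[OF assms(2), of e u u] by auto
    ultimately show ?thesis using t(1) es by auto
  next
    assume "length es = 2"
    then obtain e f u v x where es: "es = [e, f]" "vs = [u, v, x]"
      using w(1) by (auto simp: length_Suc_conv numeral_2_eq_2)
    then have "x = u" "u \<noteq> v" "e \<noteq> f" and e: "e \<in> edges G" "ends G e = {u, v}"
      and f: "f \<in> edges G" "ends G f = {v, u}"
      using w(2-4) w(6)[of 0] w(6)[of 1] by auto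
    moreover have "\<sigma> e u v \<otimes>\<^bsub>\<Gamma>\<^esub> \<sigma> f v u = \<one>\<^bsub>\<Gamma>\<^esub>"
      using t(3) es \<open>x = u\<close> gaining_carrier[OF assms(2) f] by auto
    moreover have "C = {e, f}" "ends G f = {u, v}"
      using t(1) es(1) f(2) by auto
    ultimately show ?thesis by blast
  next
    assume "length es = 3"
    then obtain e f g u v x y where es: "es = [e, f, g]" "vs = [u, v, x, y]"
      using w(1) by (auto simp: length_Suc_conv numeral_3_eq_3)
    then have eqs: "y = u" "distinct [u, v, x]" "distinct [e, f, g]"
      and e: "e \<in> edges G" "ends G e = {u, v}"
      and f: "f \<in> edges G" "ends G f = {v, x}"
      and g: "g \<in> edges G" "ends G g = {x, u}"
      using w(2-4) w(6)[of 0] w(6)[of 1] w(6)[of 2] by auto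
    moreover have "\<sigma> e u v \<otimes>\<^bsub>\<Gamma>\<^esub> (\<sigma> f v x \<otimes>\<^bsub>\<Gamma>\<^esub> \<sigma> g x u) = \<one>\<^bsub>\<Gamma>\<^esub>"
      using t(3) es eqs(1) gaining_carrier[OF assms(2) g] by auto
    moreover have "C = {e, f, g}" using t(1) es(1) by simp
    ultimately show ?thesis by blast
  qed
qed

lemma digon_balanced_iff:
  assumes "group \<Gamma>" "is_graph G" "is_gaining \<Gamma> G \<sigma>" "e \<in> edges G" "f \<in> edges G" "e \<noteq> f"
    and "ends G e = {x, y}" "ends G f = {x, y}" "x \<noteq> y"
  shows "{e, f} \<in> balanced_cycles \<Gamma> G \<sigma> \<longleftrightarrow> \<sigma> e x y = \<sigma> f x y"
proof -
  interpret group \<Gamma> by fact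
  have c: "\<sigma> e x y \<in> carrier \<Gamma>" "\<sigma> f x y \<in> carrier \<Gamma>"
    using gaining_carrier[OF assms(3)] assms by auto
  have r: "\<sigma> e y x = inv\<^bsub>\<Gamma>\<^esub> (\<sigma> e x y)" "\<sigma> f y x = inv\<^bsub>\<Gamma>\<^esub> (\<sigma> f x y)"
    using gaining_reverse[OF assms(3)] assms by auto
  show ?thesis
  proof
    assume "{e, f} \<in> balanced_cycles \<Gamma> G \<sigma>"
    moreover have "card {e, f} = 2" using assms(6) by simp
    ultimately obtain u v e' f' where *: "{e, f} = {e', f'}" "ends G e' = {u, v}" "u \<noteq> v"
      "\<sigma> e' u v \<otimes>\<^bsub>\<Gamma>\<^esub> \<sigma> f' v u = \<one>\<^bsub>\<Gamma>\<^esub>"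
      using balanced_cycle_card_le_3(2)[OF assms(1,3), of "{e, f}"] by fastforce
    from *(1) have "(e' = e \<and> f' = f) \<or> (e' = f \<and> f' = e)"
      by (auto simp: doubleton_eq_iff)
    moreover from this *(2) assms have "(u = x \<and> v = y) \<or> (u = y \<and> v = x)"
      by (auto simp: doubleton_eq_iff)
    ultimately show "\<sigma> e x y = \<sigma> f x y"
      using *(4) c r by (metis inv_closed inv_inv inv_equality)
  next
    assume eq: "\<sigma> e x y = \<sigma> f x y"
    have "traverses_cycle G [x, y, x] [e, f]"
      using assms graph_ends_verts[OF assms(2,4,7)]
      by (auto simp: traverses_cycle_def is_walk_def less_Suc_eq)
    moreover have "walk_gain \<Gamma> \<sigma> [x, y, x] [e, f] = \<one>\<^bsub>\<Gamma>\<^esub>"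
      using c r eq by simp
    ultimately show "{e, f} \<in> balanced_cycles \<Gamma> G \<sigma>"
      unfolding balanced_cycles_def by force
  qed
qed

text \<open>The six ways to read a triangle with gains \<open>p\<close>, \<open>q\<close>,
  \<open>s\<close>: three starting points and two directions. Rotation is the fact
  \<open>cyc\<close>, reversal is inversion.\<close>

lemma (in group) mult3_eq_one_iff:
  assumes "p \<in> carrier G" "q \<in> carrier G" "s \<in> carrier G"
  shows "p \<otimes> (q \<otimes> inv s) = \<one> \<longleftrightarrow> p \<otimes> q = s"
    and "q \<otimes> (inv s \<otimes> p) = \<one> \<longleftrightarrow> p \<otimes> q = s"
    and "inv s \<otimes> (p \<otimes> q) = \<one> \<longleftrightarrow> p \<otimes> q = s"
    and "s \<otimes> (inv q \<otimes> inv p) = \<one> \<longleftrightarrow> p \<otimes> q = s"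
    and "inv q \<otimes> (inv p \<otimes> s) = \<one> \<longleftrightarrow> p \<otimes> q = s"
    and "inv p \<otimes> (s \<otimes> inv q) = \<one> \<longleftrightarrow> p \<otimes> q = s"
proof -
  have cyc: "x \<otimes> y = \<one> \<longleftrightarrow> y \<otimes> x = \<one>" if "x \<in> carrier G" "y \<in> carrier G" for x y
    using that by (metis inv_equality r_inv l_inv)
  have base: "x \<otimes> inv y = \<one> \<longleftrightarrow> x = y" if "x \<in> carrier G" "y \<in> carrier G" for x y
    using that by (metis inv_closed inv_equality inv_inv r_inv)
  show 1: "p \<otimes> (q \<otimes> inv s) = \<one> \<longleftrightarrow> p \<otimes> q = s"
    using assms base[of "p \<otimes> q" s] by (simp add: m_assoc)
  show 2: "q \<otimes> (inv s \<otimes> p) = \<one> \<longleftrightarrow> p \<otimes> q = s"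
    using assms 1 cyc[of p "q \<otimes> inv s"] by (simp add: m_assoc)
  show "inv s \<otimes> (p \<otimes> q) = \<one> \<longleftrightarrow> p \<otimes> q = s"
    using assms 2 cyc[of q "inv s \<otimes> p"] by (simp add: m_assoc)
  show 4: "s \<otimes> (inv q \<otimes> inv p) = \<one> \<longleftrightarrow> p \<otimes> q = s"
    using assms base[of s "p \<otimes> q"] by (auto simp: inv_mult_group)
  show 5: "inv q \<otimes> (inv p \<otimes> s) = \<one> \<longleftrightarrow> p \<otimes> q = s"
    using assms 4 cyc[of s "inv q \<otimes> inv p"] by (simp add: m_assoc)
  show "inv p \<otimes> (s \<otimes> inv q) = \<one> \<longleftrightarrow> p \<otimes> q = s"
    using assms 5 cyc[of "inv q" "inv p \<otimes> s"] by (simp add: m_assoc)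
qed

lemma triangle_balanced_iff:
  assumes "group \<Gamma>" "is_graph G" "is_gaining \<Gamma> G \<sigma>" "e \<in> edges G" "f \<in> edges G" "g \<in> edges G"
    and "ends G e = {x, y}" "ends G f = {y, z}" "ends G g = {x, z}" "distinct [x, y, z]"
  shows "{e, f, g} \<in> balanced_cycles \<Gamma> G \<sigma> \<longleftrightarrow> \<sigma> e x y \<otimes>\<^bsub>\<Gamma>\<^esub> \<sigma> f y z = \<sigma> g x z"
proof -
  interpret group \<Gamma> by fact
  have c: "\<sigma> e x y \<in> carrier \<Gamma>" "\<sigma> f y z \<in> carrier \<Gamma>" "\<sigma> g x z \<in> carrier \<Gamma>"
    using gaining_carrier[OF assms(3)] assms by auto
  have r: "\<sigma> e y x = inv\<^bsub>\<Gamma>\<^esub> (\<sigma> e x y)" "\<sigma> f z y = inv\<^bsub>\<Gamma>\<^esub> (\<sigma> f y z)" "\<sigma> g z x = inv\<^bsub>\<Gamma>\<^esub> (\<sigma> g x z)"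
    using gaining_reverse[OF assms(3)] assms by auto
  note iffs = mult3_eq_one_iff[OF c]
  have ne: "distinct [e, f, g]"
    using assms by (auto simp: doubleton_eq_iff)
  show ?thesis
  proof
    assume "{e, f, g} \<in> balanced_cycles \<Gamma> G \<sigma>"
    moreover have card3: "card {e, f, g} = 3" using ne by simp
    \<comment> \<open>Three edges rule out the loop and the digon.\<close>
    moreover have "{e, f, g} \<noteq> {e'}" "{e, f, g} \<noteq> {e', f'}" for e' f'
      using card3 card_insert_le_m1[of 2 "{f'}" e'] by auto
    ultimately obtain u v w e' f' g' where *: "{e, f, g} = {e', f', g'}" "distinct [u, v, w]"
      "distinct [e', f', g']" "ends G e' = {u, v}" "ends G f' = {v, w}" "ends G g' = {w, u}"
      "\<sigma> e' u v \<otimes>\<^bsub>\<Gamma>\<^esub> (\<sigma> f' v w \<otimes>\<^bsub>\<Gamma>\<^esub> \<sigma> g' w u) = \<one>\<^bsub>\<Gamma>\<^esub>"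
      using balanced_cycle_card_le_3(2)[OF assms(1,3), of "{e, f, g}"] by (auto 0 4)
    have e': "e' \<in> {e, f, g}" "f' \<in> {e, f, g}" "g' \<in> {e, f, g}"
      using *(1) by auto
    \<comment> \<open>Each matching of the two triples determines \<open>u\<close>,
      \<open>v\<close>, \<open>w\<close>, and the equation is then one of the readings in
      \<open>iffs\<close>.\<close>
    then consider "e' = e" "f' = f" "g' = g" | "e' = e" "f' = g" "g' = f" | "e' = f" "f' = e" "g' = g"
      | "e' = f" "f' = g" "g' = e" | "e' = g" "f' = e" "g' = f" | "e' = g" "f' = f" "g' = e"
      using *(3) by auto
    then show "\<sigma> e x y \<otimes>\<^bsub>\<Gamma>\<^esub> \<sigma> f y z = \<sigma> g x z"
    proof cases
      case 1
      then have "u = x \<and> v = y \<and> w = z" using *(2,4-6) assms(7-10) by (auto simp: doubleton_eq_iff)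
      then show ?thesis using 1 *(7) iffs r by simp
    next
      case 2
      then have "u = y \<and> v = x \<and> w = z" using *(2,4-6) assms(7-10) by (auto simp: doubleton_eq_iff)
      then show ?thesis using 2 *(7) iffs r by simp
    next
      case 3
      then have "u = z \<and> v = y \<and> w = x" using *(2,4-6) assms(7-10) by (auto simp: doubleton_eq_iff)
      then show ?thesis using 3 *(7) iffs r by simp
    next
      case 4
      then have "u = y \<and> v = z \<and> w = x" using *(2,4-6) assms(7-10) by (auto simp: doubleton_eq_iff)
      then show ?thesis using 4 *(7) iffs r by simp
    next
      case 5
      then have "u = z \<and> v = x \<and> w = y" using *(2,4-6) assms(7-10) by (auto simp: doubleton_eq_iff)
      then show ?thesis using 5 *(7) iffs r by simp
    next
      case 6
      then have "u = x \<and> v = z \<and> w = y" using *(2,4-6) assms(7-10) by (auto simp: doubleton_eq_iff)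
      then show ?thesis using 6 *(7) iffs r by simp
    qed
  next
    assume "\<sigma> e x y \<otimes>\<^bsub>\<Gamma>\<^esub> \<sigma> f y z = \<sigma> g x z"
    then have "walk_gain \<Gamma> \<sigma> [x, y, z, x] [e, f, g] = \<one>\<^bsub>\<Gamma>\<^esub>"
      using c r iffs(1) by simp
    moreover have "traverses_cycle G [x, y, z, x] [e, f, g]"
      using assms ne graph_ends_verts[OF assms(2,4,7)] graph_ends_verts[OF assms(2,5,8)]
      by (auto simp: traverses_cycle_def is_walk_def less_Suc_eq insert_commute)
    ultimately show "{e, f, g} \<in> balanced_cycles \<Gamma> G \<sigma>"
      unfolding balanced_cycles_def by force
  qed
qed

section \<open>Lines with four points\<close>

locale gain_graph =
  fixes \<Gamma> :: "('g, 'm) monoid_scheme" and G :: "('v, 'e) graph" and \<sigma> :: "'e \<Rightarrow> 'v \<Rightarrow> 'v \<Rightarrow> 'g"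
  assumes group: "group \<Gamma>" and graph: "is_graph G" and gaining: "is_gaining \<Gamma> G \<sigma>"
begin

abbreviation indep :: "'e set \<Rightarrow> bool" where
  "indep X \<equiv> X \<in> snd (frame_matroid \<Gamma> G \<sigma>)"

lemma indep_card_covered: "indep X \<Longrightarrow> card X \<le> card (covered G X)"
  by (simp add: frame_independent_iff[OF graph])

lemma finite_ends: "e \<in> edges G \<Longrightarrow> finite (ends G e)"
  by (metis finite.emptyI finite_insert graph graph_ends)

text \<open>With all pairs independent, the obstruction can only be the whole triple: it is overfull
  or a balanced triangle.\<close>

lemma dependent_triple:
  assumes "{a, b, c} \<subseteq> edges G" "distinct [a, b, c]" "\<not> indep {a, b, c}"
    and "indep {a, b}" "indep {b, c}" "indep {a, c}"
  shows "card (covered G {a, b, c}) \<le> 2 \<or>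
    ({a, b, c} \<in> balanced_cycles \<Gamma> G \<sigma> \<and>
     (\<exists>x y z. distinct [x, y, z] \<and> ends G a = {x, y} \<and> ends G b = {y, z} \<and> ends G c = {x, z}))"
proof -
  have proper: "Y \<subseteq> {a, b} \<or> Y \<subseteq> {b, c} \<or> Y \<subseteq> {a, c} \<or> Y = {a, b, c}" if "Y \<subseteq> {a, b, c}" for Y
    using that by auto
  have card3: "card {a, b, c} = 3" using assms(2) by simp
  consider C where "C \<in> balanced_cycles \<Gamma> G \<sigma>" "C \<subseteq> {a, b, c}"
    | Y where "Y \<subseteq> {a, b, c}" "card (covered G Y) < card Y"
    using assms(1,3) unfolding frame_independent_iff[OF graph] by (auto simp: not_le)
  then show ?thesis
  proof cases
    case (1 C)
    have "\<not> C \<subseteq> Z" if "indep Z" for Z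
      using that 1(1) by (simp add: frame_independent_iff[OF graph])
    then have C: "C = {a, b, c}" using proper[OF 1(2)] assms(4-6) by metis
    moreover have "{a, b, c} \<noteq> {e'}" "{a, b, c} \<noteq> {e', f'}" for e' f'
      using card3 card_insert_le_m1[of 2 "{f'}" e'] by auto
    ultimately obtain u v w e f g where *: "{a, b, c} = {e, f, g}" "distinct [u, v, w]"
      "distinct [e, f, g]" "ends G e = {u, v}" "ends G f = {v, w}" "ends G g = {w, u}"
      using balanced_cycle_card_le_3(2)[OF group gaining 1(1)] card3 by (auto 0 4)
    have I: "\<exists>x y z. distinct [x, y, z] \<and> ends G a = {x, y} \<and> ends G b = {y, z} \<and> ends G c = {x, z}"
      if "distinct [x, y, z]" "ends G a = {x, y}" "ends G b = {y, z}" "ends G c = {x, z}" for x y z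
      using that by blast
    have ends': "ends G e = {v, u}" "ends G f = {w, v}" "ends G g = {u, w}"
      using * by (simp_all add: insert_commute)
    have "e \<in> {a, b, c}" "f \<in> {a, b, c}" "g \<in> {a, b, c}"
      using *(1) by auto
    then consider "e = a" "f = b" "g = c" | "e = a" "f = c" "g = b" | "e = b" "f = a" "g = c"
      | "e = b" "f = c" "g = a" | "e = c" "f = a" "g = b" | "e = c" "f = b" "g = a"
      using *(3) by auto
    then have "\<exists>x y z. distinct [x, y, z] \<and> ends G a = {x, y} \<and> ends G b = {y, z} \<and> ends G c = {x, z}"
    proof cases
      case 1
      then show ?thesis using *(2,4-6) ends' by (intro I[of u v w]) auto
    next
      case 2
      then show ?thesis using *(2,4-6) ends' by (intro I[of v u w]) auto
    next
      case 3
      then show ?thesis using *(2,4-6) ends' by (intro I[of w v u]) auto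
    next
      case 4
      then show ?thesis using *(2,4-6) ends' by (intro I[of w u v]) auto
    next
      case 5
      then show ?thesis using *(2,4-6) ends' by (intro I[of v w u]) auto
    next
      case 6
      then show ?thesis using *(2,4-6) ends' by (intro I[of u w v]) auto
    qed
    then show ?thesis using C 1(1) by blast
  next
    case (2 Y)
    have "\<not> Y \<subseteq> Z" if "indep Z" for Z
      using that 2(2) by (auto simp: frame_independent_iff[OF graph] not_le[symmetric])
    then have "Y = {a, b, c}" using proper[OF 2(1)] assms(4-6) by metis
    then show ?thesis using 2(2) card3 by simp
  qed
qed

text \<open>The pairs with \<open>a = b\<close> make single elements independent, so there are no
  matroid loops. Maximality is not demanded: these are sets of distinct points of rank at most
  two.\<close>

definition line :: "'e set \<Rightarrow> bool" where
  "line L \<longleftrightarrow> L \<subseteq> edges G \<and> (\<forall>a \<in> L. \<forall>b \<in> L. indep {a, b}) \<and>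
     (\<forall>a \<in> L. \<forall>b \<in> L. \<forall>c \<in> L. distinct [a, b, c] \<longrightarrow> \<not> indep {a, b, c})"

text \<open>Were \<open>a\<close>, \<open>b\<close>, \<open>c\<close> a triangle, then
  \<open>d\<close> would complete a triangle with \<open>a\<close>, \<open>b\<close> and another
  with \<open>a\<close>, \<open>c\<close>, and so have the ends of \<open>c\<close> and those of
  \<open>b\<close> at once.\<close>

lemma four_points_on_line:
  assumes "line L" "{a, b, c, d} \<subseteq> L" "distinct [a, b, c, d]"
  shows "card (covered G {a, b, c}) \<le> 2"
proof (rule ccontr)
  assume not2: "\<not> card (covered G {a, b, c}) \<le> 2"
  have L: "{a, b, c, d} \<subseteq> edges G" "indep {a, b}" "indep {a, c}" "indep {a, d}" "indep {b, c}"
    "indep {b, d}" "indep {c, d}" "\<not> indep {a, b, c}" "\<not> indep {a, b, d}" "\<not> indep {a, c, d}"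
    using assms unfolding line_def by auto
  obtain x y z where xyz: "distinct [x, y, z]" "ends G a = {x, y}" "ends G b = {y, z}" "ends G c = {x, z}"
    using dependent_triple[of a b c] L assms(3) not2 by auto
  have cov: "covered G {a, b, d} = {x, y, z} \<union> ends G d" "covered G {a, c, d} = {x, y, z} \<union> ends G d"
    using xyz by (auto simp: covered_def)
  have "card {x, y, z} \<le> card ({x, y, z} \<union> ends G d)"
    using L(1) finite_ends by (intro card_mono) auto
  then have "\<not> card ({x, y, z} \<union> ends G d) \<le> 2"
    using xyz(1) by simp
  then obtain p q r p' q' r' where
    1: "distinct [p, q, r]" "ends G a = {p, q}" "ends G b = {q, r}" "ends G d = {p, r}" and
    2: "distinct [p', q', r']" "ends G a = {p', q'}" "ends G c = {q', r'}" "ends G d = {p', r'}"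
    using dependent_triple[of a b d] dependent_triple[of a c d] L assms(3) by (auto simp: cov)
  have "q = y" "p = x" "r = z" using 1 xyz by (auto simp: doubleton_eq_iff)
  moreover have "q' = x" "p' = y" "r' = z" using 2 xyz by (auto simp: doubleton_eq_iff)
  ultimately show False using 1(4) 2(4) xyz(1) by (auto simp: doubleton_eq_iff)
qed

text \<open>Two points already cover two vertices, and by \<open>four_points_on_line\<close> no
  third point adds a vertex to them.\<close>

lemma line_ends:
  assumes "line L" "{a, b, c, d} \<subseteq> L" "distinct [a, b, c, d]"
  obtains P where "card P = 2" "\<And>e. e \<in> L \<Longrightarrow> ends G e \<subseteq> P"
proof
  let ?P = "covered G {a, b}"
  have fin: "finite (covered G X)" if "X \<subseteq> L" for X
    using that assms(1) by (intro finite_covered[OF graph]) (auto simp: line_def)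
  have ge2: "2 \<le> card ?P"
    using indep_card_covered[of "{a, b}"] assms by (simp add: line_def)
  have eq: "covered G {a, b, e} = ?P \<and> card ?P = 2" if e: "e \<in> L" "e \<notin> {a, b}" for e
  proof -
    \<comment> \<open>One of \<open>c\<close> and \<open>d\<close> differs from \<open>e\<close> and
      serves as the fourth point.\<close>
    obtain f where "f \<in> {c, d}" "f \<noteq> e"
      using assms(3) by auto
    then have "card (covered G {a, b, e}) \<le> 2"
      using e assms by (intro four_points_on_line[OF assms(1), of a b e f]) auto
    moreover have "?P \<subseteq> covered G {a, b, e}"
      by (intro covered_mono) auto
    moreover have "finite (covered G {a, b, e})"
      using e assms(2) by (intro fin) auto
    ultimately have "?P = covered G {a, b, e}"
      using ge2 by (intro card_seteq) auto
    with \<open>card (covered G {a, b, e}) \<le> 2\<close> ge2 show ?thesis by simp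
  qed
  show "card ?P = 2"
    using eq[of c] assms(2,3) by auto
  show "ends G e \<subseteq> ?P" if "e \<in> L" for e
  proof (cases "e \<in> {a, b}")
    case True
    then show ?thesis by (auto simp: covered_def)
  next
    case False
    then show ?thesis using eq[of e] that by (auto simp: covered_def)
  qed
qed

lemma card_2_inter:
  assumes "card P = 2" "card R = 2" "P \<noteq> R" "x \<in> P" "x \<in> R"
  shows "P \<inter> R = {x}"
  using assms by (auto simp: card_2_iff)

text \<open>Each line lives on a pair of vertices. The joints \<open>a0\<close>, \<open>a1\<close>,
  \<open>a2\<close> together need three vertices, so the pairs differ. A joint is on two lines,
  hence at the one vertex common to their pairs, and is a loop there. Two points of a line cannot
  sit at a single vertex, so every other point is a link.\<close>

lemma triangle_of_lines:
  assumes lines: "line L01" "line L02" "line L12"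
    and four: "{a0, a1, c, c'} \<subseteq> L01" "distinct [a0, a1, c, c']" "{a0, a2, d, d'} \<subseteq> L02" "distinct [a0, a2, d, d']"
      "{a1, a2, f, f'} \<subseteq> L12" "distinct [a1, a2, f, f']"
    and joints: "indep {a0, a1, a2}"
  obtains x0 x1 x2 where "distinct [x0, x1, x2]"
    "\<And>e. e \<in> L01 - {a0, a1} \<Longrightarrow> ends G e = {x0, x1}"
    "\<And>e. e \<in> L02 - {a0, a2} \<Longrightarrow> ends G e = {x0, x2}"
    "\<And>e. e \<in> L12 - {a1, a2} \<Longrightarrow> ends G e = {x1, x2}"
proof -
  obtain P01 where P01: "card P01 = 2" "\<And>e. e \<in> L01 \<Longrightarrow> ends G e \<subseteq> P01"
    using line_ends[OF lines(1) four(1,2)] by metis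
  obtain P02 where P02: "card P02 = 2" "\<And>e. e \<in> L02 \<Longrightarrow> ends G e \<subseteq> P02"
    using line_ends[OF lines(2) four(3,4)] by metis
  obtain P12 where P12: "card P12 = 2" "\<And>e. e \<in> L12 \<Longrightarrow> ends G e \<subseteq> P12"
    using line_ends[OF lines(3) four(5,6)] by metis
  have in_lines: "a0 \<in> L01" "a1 \<in> L01" "a0 \<in> L02" "a2 \<in> L02" "a1 \<in> L12" "a2 \<in> L12"
    using four by auto
  have "card {a0, a1, a2} = 3" using four(2,4,6) by simp
  then have "\<not> covered G {a0, a1, a2} \<subseteq> P" if "card P = 2" for P
    using indep_card_covered[OF joints] that card_mono[of P "covered G {a0, a1, a2}"] card.infinite[of P]
    by fastforce
  then have no: "\<not> (ends G a0 \<subseteq> P \<and> ends G a1 \<subseteq> P \<and> ends G a2 \<subseteq> P)" if "card P = 2" for P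
    using that by (auto simp: covered_def)
  have ne: "P01 \<noteq> P02" "P01 \<noteq> P12" "P02 \<noteq> P12"
    using no[OF P01(1)] no[OF P02(1)] no[OF P12(1)] P01(2) P02(2) P12(2) in_lines by metis+
  have nonempty: "\<exists>x. x \<in> ends G e" if "line L" "e \<in> L" for e L
  proof -
    have "e \<in> edges G" using that by (auto simp: line_def)
    then show ?thesis using graph_ends[OF graph] by blast
  qed
  obtain x0 where x0: "x0 \<in> ends G a0" using nonempty[OF lines(1) in_lines(1)] by blast
  obtain x1 where x1: "x1 \<in> ends G a1" using nonempty[OF lines(1) in_lines(2)] by blast
  obtain x2 where x2: "x2 \<in> ends G a2" using nonempty[OF lines(2) in_lines(4)] by blast
  have mem: "x0 \<in> P01" "x0 \<in> P02" "x1 \<in> P01" "x1 \<in> P12" "x2 \<in> P02" "x2 \<in> P12"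
    using x0 x1 x2 P01(2) P02(2) P12(2) in_lines by blast+
  have loops: "ends G a0 = {x0}" "ends G a1 = {x1}" "ends G a2 = {x2}"
    using card_2_inter[OF P01(1) P02(1) ne(1) mem(1,2)] card_2_inter[OF P01(1) P12(1) ne(2) mem(3,4)]
      card_2_inter[OF P02(1) P12(1) ne(3) mem(5,6)]
      P01(2)[OF in_lines(1)] P02(2)[OF in_lines(3)] P01(2)[OF in_lines(2)] P12(2)[OF in_lines(5)]
      P02(2)[OF in_lines(4)] P12(2)[OF in_lines(6)] x0 x1 x2 by blast+
  have not_same: "\<not> (ends G e \<subseteq> {x} \<and> ends G f \<subseteq> {x})" if "line L" "e \<in> L" "f \<in> L" "e \<noteq> f" for L e f x
  proof
    assume "ends G e \<subseteq> {x} \<and> ends G f \<subseteq> {x}"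
    then have "covered G {e, f} \<subseteq> {x}" by (auto simp: covered_def)
    then have "card (covered G {e, f}) \<le> 1"
      using card_mono[of "{x}"] by fastforce
    moreover have "indep {e, f}" using that unfolding line_def by blast
    ultimately show False using indep_card_covered[of "{e, f}"] that(4) by simp
  qed
  have dist: "x0 \<noteq> x1" "x0 \<noteq> x2" "x1 \<noteq> x2"
    using not_same[OF lines(1) in_lines(1,2)] not_same[OF lines(2) in_lines(3,4)]
      not_same[OF lines(3) in_lines(5,6)] four(2,4,6) loops by auto
  have P: "P01 = {x0, x1}" "P02 = {x0, x2}" "P12 = {x1, x2}"
    using mem dist P01(1) P02(1) P12(1) by (auto simp: card_2_iff)
  have link: "ends G e = {x, y}"
    if "line L" "e \<in> L" "a \<in> L" "b \<in> L" "e \<notin> {a, b}" "ends G a = {x}" "ends G b = {y}" "ends G e \<subseteq> {x, y}"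
    for L e a b x y
    using not_same[OF that(1,2,3), of x] not_same[OF that(1,2,4), of y] that by auto
  show thesis
  proof (rule that[of x0 x1 x2])
    show "distinct [x0, x1, x2]" using dist by simp
    show "ends G e = {x0, x1}" if "e \<in> L01 - {a0, a1}" for e
      by (rule link[OF lines(1) _ in_lines(1,2)]) (use that loops P01(2) P in auto)
    show "ends G e = {x0, x2}" if "e \<in> L02 - {a0, a2}" for e
      by (rule link[OF lines(2) _ in_lines(3,4)]) (use that loops P02(2) P in auto)
    show "ends G e = {x1, x2}" if "e \<in> L12 - {a1, a2}" for e
      by (rule link[OF lines(3) _ in_lines(5,6)]) (use that loops P12(2) P in auto)
  qed
qed

end

section \<open>Composition for counting monadic second-order logic\<close>

text \<open>Independence in an amalgam sees the part of a set in \<open>A\<close> only through its type under \<open>\<alpha>\<close>,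
  while the dependence on the part in \<open>B\<close> is arbitrary.\<close>

definition amalgam :: "'e set \<Rightarrow> 'e set \<Rightarrow> ('e set \<Rightarrow> 'q) \<Rightarrow> ('q \<Rightarrow> 'e set \<Rightarrow> bool) \<Rightarrow> 'e hypergraph" where
  "amalgam A B \<alpha> P = (A \<union> B, {Z. Z \<subseteq> A \<union> B \<and> P (\<alpha> (Z \<inter> A)) (Z \<inter> B)})"

definition typed_assignment :: "'q set \<Rightarrow> 'e set \<Rightarrow> ('e set \<Rightarrow> 'q) \<Rightarrow> (nat \<Rightarrow> 'e set) \<Rightarrow> bool" where
  "typed_assignment Q A \<alpha> \<theta> \<longleftrightarrow> finite A \<and> \<alpha> ` Pow A \<subseteq> Q \<and> (\<forall>i. \<theta> i \<subseteq> A)"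

text \<open>A Myhill-Nerode condition: left parts with equal codes are not separated by \<phi> in
  any right context \<open>B\<close>, \<open>P\<close>, \<eta>. The ground set \<open>A\<close> is
  common to both sides; only types and assignments vary.\<close>

definition determines ::
  "'q set \<Rightarrow> ('e set \<Rightarrow> ('e set \<Rightarrow> 'q) \<Rightarrow> (nat \<Rightarrow> 'e set) \<Rightarrow> 'c) \<Rightarrow> cmso \<Rightarrow> bool" where
  "determines Q code \<phi> \<longleftrightarrow> (\<forall>A \<alpha> \<theta> \<alpha>' \<theta>' B P \<eta>.
     typed_assignment Q A \<alpha> \<theta> \<longrightarrow> typed_assignment Q A \<alpha>' \<theta>' \<longrightarrow> code A \<alpha> \<theta> = code A \<alpha>' \<theta>' \<longrightarrow>
     finite B \<longrightarrow> A \<inter> B = {} \<longrightarrow> (\<forall>i. \<eta> i \<subseteq> B) \<longrightarrow>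
     sat (amalgam A B \<alpha> P) (\<lambda>i. \<theta> i \<union> \<eta> i) \<phi> = sat (amalgam A B \<alpha>' P) (\<lambda>i. \<theta>' i \<union> \<eta> i) \<phi>)"

text \<open>The premises are symmetric in the two sides, so one implication suffices.\<close>

lemma determinesI:
  assumes "\<And>A \<alpha> \<theta> \<alpha>' \<theta>' B P \<eta>. typed_assignment Q A \<alpha> \<theta> \<Longrightarrow> typed_assignment Q A \<alpha>' \<theta>' \<Longrightarrow>
     code A \<alpha> \<theta> = code A \<alpha>' \<theta>' \<Longrightarrow> finite B \<Longrightarrow> A \<inter> B = {} \<Longrightarrow> (\<forall>i. \<eta> i \<subseteq> B) \<Longrightarrow>
     sat (amalgam A B \<alpha> P) (\<lambda>i. \<theta> i \<union> \<eta> i) \<phi> \<Longrightarrow> sat (amalgam A B \<alpha>' P) (\<lambda>i. \<theta>' i \<union> \<eta> i) \<phi>"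
  shows "determines Q code \<phi>"
  unfolding determines_def using assms by (smt (verit, best))

lemma determinesD:
  assumes "determines Q code \<phi>" "typed_assignment Q A \<alpha> \<theta>" "typed_assignment Q A \<alpha>' \<theta>'"
    "code A \<alpha> \<theta> = code A \<alpha>' \<theta>'" "finite B" "A \<inter> B = {}" "\<forall>i. \<eta> i \<subseteq> B"
  shows "sat (amalgam A B \<alpha> P) (\<lambda>i. \<theta> i \<union> \<eta> i) \<phi> \<longleftrightarrow> sat (amalgam A B \<alpha>' P) (\<lambda>i. \<theta>' i \<union> \<eta> i) \<phi>"
  using assms unfolding determines_def by blast

text \<open>The natural type of codes changes from formula to formula; renumbering by natural
  numbers keeps the induction in \<open>composition\<close> within one type.\<close>

lemma encode_determines:
  fixes code :: "'e set \<Rightarrow> ('e set \<Rightarrow> 'q) \<Rightarrow> (nat \<Rightarrow> 'e set) \<Rightarrow> 'c"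
  assumes "finite T" "\<And>A \<alpha> \<theta>. typed_assignment Q A \<alpha> \<theta> \<Longrightarrow> code A \<alpha> \<theta> \<in> T" "determines Q code \<phi>"
  shows "\<exists>(code' :: 'e set \<Rightarrow> ('e set \<Rightarrow> 'q) \<Rightarrow> (nat \<Rightarrow> 'e set) \<Rightarrow> nat) b.
    (\<forall>A \<alpha> \<theta>. typed_assignment Q A \<alpha> \<theta> \<longrightarrow> code' A \<alpha> \<theta> < b) \<and> determines Q code' \<phi>"
proof -
  obtain enc :: "'c \<Rightarrow> nat" where enc: "bij_betw enc T {0..<card T}"
    using ex_bij_betw_finite_nat[OF assms(1)] by blast
  define code' where "code' A \<alpha> \<theta> = enc (code A \<alpha> \<theta>)" for A :: "'e set" and \<alpha> :: "'e set \<Rightarrow> 'q" and \<theta>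
  have "code' A \<alpha> \<theta> < card T" if "typed_assignment Q A \<alpha> \<theta>" for A \<alpha> \<theta>
    using bij_betwE[OF enc] assms(2)[OF that] by (auto simp: code'_def)
  moreover have "determines Q code' \<phi>"
  proof (rule determinesI)
    fix A :: "'e set" and \<alpha> \<alpha>' :: "'e set \<Rightarrow> 'q" and \<theta> \<theta>' B P \<eta>
    assume t: "typed_assignment Q A \<alpha> \<theta>" "typed_assignment Q A \<alpha>' \<theta>'" "code' A \<alpha> \<theta> = code' A \<alpha>' \<theta>'"
      "finite B" "A \<inter> B = {}" "\<forall>i. \<eta> i \<subseteq> B" "sat (amalgam A B \<alpha> P) (\<lambda>i. \<theta> i \<union> \<eta> i) \<phi>"
    have "code A \<alpha> \<theta> = code A \<alpha>' \<theta>'"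
      using t(3) enc assms(2)[OF t(1)] assms(2)[OF t(2)] by (auto simp: code'_def bij_betw_def inj_on_def)
    then show "sat (amalgam A B \<alpha>' P) (\<lambda>i. \<theta>' i \<union> \<eta> i) \<phi>"
      using determinesD[OF assms(3) t(1,2) _ t(4-6)] t(7) by blast
  qed
  ultimately show ?thesis by blast
qed

text \<open>A Feferman-Vaught argument by induction on the formula: the code is a truth value, a
  type, a residue, a pair of codes, or the set of codes reachable by one more choice.\<close>

lemma composition:
  fixes Q :: "'q set"
  assumes "finite Q" "well_formed \<phi>"
  shows "\<exists>(code :: 'e set \<Rightarrow> ('e set \<Rightarrow> 'q) \<Rightarrow> (nat \<Rightarrow> 'e set) \<Rightarrow> nat) b.
    (\<forall>A \<alpha> \<theta>. typed_assignment Q A \<alpha> \<theta> \<longrightarrow> code A \<alpha> \<theta> < b) \<and> determines Q code \<phi>"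
  using assms(2)
proof (induction \<phi>)
  case (Subset i j)
  show ?case
  proof (rule encode_determines[where T = UNIV and code = "\<lambda>A \<alpha> \<theta>. \<theta> i \<subseteq> \<theta> j"])
    show "determines Q (\<lambda>A (\<alpha> :: 'e set \<Rightarrow> 'q) \<theta>. \<theta> i \<subseteq> \<theta> j) (Subset i j)"
    proof (rule determinesI)
      fix A :: "'e set" and \<alpha> \<alpha>' :: "'e set \<Rightarrow> 'q" and \<theta> \<theta>' B P \<eta>
      assume t: "typed_assignment Q A \<alpha> \<theta>" "typed_assignment Q A \<alpha>' \<theta>'"
        "(\<theta> i \<subseteq> \<theta> j) = (\<theta>' i \<subseteq> \<theta>' j)"
        "finite B" "A \<inter> B = {}" "\<forall>i. \<eta> i \<subseteq> B" "sat (amalgam A B \<alpha> P) (\<lambda>i. \<theta> i \<union> \<eta> i) (Subset i j)"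
      have "\<theta> k \<subseteq> A" "\<theta>' k \<subseteq> A" "\<eta> k \<subseteq> B" for k
        using t by (auto simp: typed_assignment_def)
      \<comment> \<open>As \<open>A\<close> and \<open>B\<close> are disjoint, inclusion splits into
        one inclusion in each half.\<close>
      then have "\<theta> i \<inter> \<eta> j = {}" "\<eta> i \<inter> \<theta> j = {}"
        using t(5) by blast+
      then have "\<theta> i \<subseteq> \<theta> j" "\<eta> i \<subseteq> \<eta> j"
        using t(7) by auto
      then show "sat (amalgam A B \<alpha>' P) (\<lambda>i. \<theta>' i \<union> \<eta> i) (Subset i j)"
        using t(3) by auto
    qed
  qed auto
next
  case (Hyp i)
  show ?case
  proof (rule encode_determines[where T = Q and code = "\<lambda>A \<alpha> \<theta>. \<alpha> (\<theta> i)"])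
    show "determines Q (\<lambda>A (\<alpha> :: 'e set \<Rightarrow> 'q) \<theta>. \<alpha> (\<theta> i)) (Hyp i)"
    proof (rule determinesI)
      fix A :: "'e set" and \<alpha> \<alpha>' :: "'e set \<Rightarrow> 'q" and \<theta> \<theta>' B P \<eta>
      assume t: "typed_assignment Q A \<alpha> \<theta>" "typed_assignment Q A \<alpha>' \<theta>'" "\<alpha> (\<theta> i) = \<alpha>' (\<theta>' i)"
        "finite B" "A \<inter> B = {}" "\<forall>i. \<eta> i \<subseteq> B" "sat (amalgam A B \<alpha> P) (\<lambda>i. \<theta> i \<union> \<eta> i) (Hyp i)"
      have "\<theta> i \<subseteq> A" "\<theta>' i \<subseteq> A" "\<eta> i \<subseteq> B"
        using t by (auto simp: typed_assignment_def)
      then have "(\<theta> i \<union> \<eta> i) \<inter> A = \<theta> i" "(\<theta> i \<union> \<eta> i) \<inter> B = \<eta> i"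
        "(\<theta>' i \<union> \<eta> i) \<inter> A = \<theta>' i" "(\<theta>' i \<union> \<eta> i) \<inter> B = \<eta> i"
        using t(5) by blast+
      then show "sat (amalgam A B \<alpha>' P) (\<lambda>i. \<theta>' i \<union> \<eta> i) (Hyp i)"
        using t(3,7) \<open>\<theta>' i \<subseteq> A\<close> \<open>\<eta> i \<subseteq> B\<close> by (auto simp: amalgam_def)
    qed
  qed (use assms(1) in \<open>auto simp: typed_assignment_def\<close>)
next
  case (CardMod i p q)
  then have "q > 0" by simp
  show ?case
  proof (rule encode_determines[where T = "{..<q}" and code = "\<lambda>A \<alpha> \<theta>. card (\<theta> i) mod q"])
    show "determines Q (\<lambda>A (\<alpha> :: 'e set \<Rightarrow> 'q) \<theta>. card (\<theta> i) mod q) (CardMod i p q)"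
    proof (rule determinesI)
      fix A :: "'e set" and \<alpha> \<alpha>' :: "'e set \<Rightarrow> 'q" and \<theta> \<theta>' B P \<eta>
      assume t: "typed_assignment Q A \<alpha> \<theta>" "typed_assignment Q A \<alpha>' \<theta>'"
        "card (\<theta> i) mod q = card (\<theta>' i) mod q"
        "finite B" "A \<inter> B = {}" "\<forall>i. \<eta> i \<subseteq> B" "sat (amalgam A B \<alpha> P) (\<lambda>i. \<theta> i \<union> \<eta> i) (CardMod i p q)"
      have *: "\<theta> i \<subseteq> A" "\<theta>' i \<subseteq> A" "\<eta> i \<subseteq> B" "finite A"
        using t by (auto simp: typed_assignment_def)
      then have "finite (\<theta> i)" "finite (\<theta>' i)" "finite (\<eta> i)"
        using t(4) finite_subset by blast+
      then have "card (\<theta> i \<union> \<eta> i) = card (\<theta> i) + card (\<eta> i)"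
        "card (\<theta>' i \<union> \<eta> i) = card (\<theta>' i) + card (\<eta> i)"
        using * t(5) by (intro card_Un_disjoint; blast)+
      then show "sat (amalgam A B \<alpha>' P) (\<lambda>i. \<theta>' i \<union> \<eta> i) (CardMod i p q)"
        using t(3,7) by (metis sat.simps(3) mod_add_left_eq)
    qed
  qed (use \<open>q > 0\<close> in auto)
next
  case (Neg \<phi>)
  \<comment> \<open>Equal codes give equivalent truth values, so the code of the negated formula
    serves again.\<close>
  then show ?case
    by (simp add: determines_def)
next
  case (Conj \<phi> \<psi>)
  then obtain f g :: "'e set \<Rightarrow> ('e set \<Rightarrow> 'q) \<Rightarrow> (nat \<Rightarrow> 'e set) \<Rightarrow> nat" and b c
    where f: "\<forall>A \<alpha> \<theta>. typed_assignment Q A \<alpha> \<theta> \<longrightarrow> f A \<alpha> \<theta> < b" "determines Q f \<phi>"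
      and g: "\<forall>A \<alpha> \<theta>. typed_assignment Q A \<alpha> \<theta> \<longrightarrow> g A \<alpha> \<theta> < c" "determines Q g \<psi>"
    by auto
  show ?case
  proof (rule encode_determines[where T = "{..<b} \<times> {..<c}" and code = "\<lambda>A \<alpha> \<theta>. (f A \<alpha> \<theta>, g A \<alpha> \<theta>)"])
    show "determines Q (\<lambda>A \<alpha> \<theta>. (f A \<alpha> \<theta>, g A \<alpha> \<theta>)) (Conj \<phi> \<psi>)"
    proof (rule determinesI)
      fix A :: "'e set" and \<alpha> \<alpha>' :: "'e set \<Rightarrow> 'q" and \<theta> \<theta>' B P \<eta>
      assume t: "typed_assignment Q A \<alpha> \<theta>" "typed_assignment Q A \<alpha>' \<theta>'"
        "(f A \<alpha> \<theta>, g A \<alpha> \<theta>) = (f A \<alpha>' \<theta>', g A \<alpha>' \<theta>')"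
        "finite B" "A \<inter> B = {}" "\<forall>i. \<eta> i \<subseteq> B" "sat (amalgam A B \<alpha> P) (\<lambda>i. \<theta> i \<union> \<eta> i) (Conj \<phi> \<psi>)"
      show "sat (amalgam A B \<alpha>' P) (\<lambda>i. \<theta>' i \<union> \<eta> i) (Conj \<phi> \<psi>)"
        using determinesD[OF f(2) t(1,2) _ t(4-6), of P] determinesD[OF g(2) t(1,2) _ t(4-6), of P] t(3,7)
        by simp
    qed
  qed (use f(1) g(1) in auto)
next
  case (Exists i \<phi>)
  then obtain f :: "'e set \<Rightarrow> ('e set \<Rightarrow> 'q) \<Rightarrow> (nat \<Rightarrow> 'e set) \<Rightarrow> nat" and b
    where f: "\<And>A \<alpha> \<theta>. typed_assignment Q A \<alpha> \<theta> \<Longrightarrow> f A \<alpha> \<theta> < b" "determines Q f \<phi>"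
    by auto
  \<comment> \<open>All choices for the left part of the quantified set are tried; the codes
    obtained form one of \<open>2 ^ b\<close> sets.\<close>
  define F where "F A \<alpha> \<theta> = (\<lambda>X. f A \<alpha> (\<theta>(i := X))) ` Pow A" for A \<alpha> \<theta>
  have upd: "typed_assignment Q A \<alpha> (\<theta>(i := X))" if "typed_assignment Q A \<alpha> \<theta>" "X \<subseteq> A"
    for A :: "'e set" and \<alpha> :: "'e set \<Rightarrow> 'q" and \<theta> X
    using that by (simp add: typed_assignment_def)
  show ?case
  proof (rule encode_determines[where T = "Pow {..<b}" and code = F])
    show "F A \<alpha> \<theta> \<in> Pow {..<b}" if "typed_assignment Q A \<alpha> \<theta>" for A \<alpha> \<theta>
      using f(1)[OF upd[OF that]] by (auto simp: F_def)
    show "determines Q F (Exists i \<phi>)"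
    proof (rule determinesI)
      fix A :: "'e set" and \<alpha> \<alpha>' :: "'e set \<Rightarrow> 'q" and \<theta> \<theta>' B P \<eta>
      assume t: "typed_assignment Q A \<alpha> \<theta>" "typed_assignment Q A \<alpha>' \<theta>'" "F A \<alpha> \<theta> = F A \<alpha>' \<theta>'"
        "finite B" "A \<inter> B = {}" "\<forall>i. \<eta> i \<subseteq> B" "sat (amalgam A B \<alpha> P) (\<lambda>i. \<theta> i \<union> \<eta> i) (Exists i \<phi>)"
      obtain X where X: "X \<subseteq> A \<union> B" "sat (amalgam A B \<alpha> P) ((\<lambda>i. \<theta> i \<union> \<eta> i)(i := X)) \<phi>"
        using t(7) by (auto simp: amalgam_def)
      have "f A \<alpha> (\<theta>(i := X \<inter> A)) \<in> F A \<alpha>' \<theta>'"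
        unfolding t(3)[symmetric] by (auto simp: F_def)
      \<comment> \<open>\<open>X'\<close> answers \<open>X \<inter> A\<close> on the other side,
        while the part \<open>X \<inter> B\<close> is kept.\<close>
      then obtain X' where X': "X' \<subseteq> A" "f A \<alpha> (\<theta>(i := X \<inter> A)) = f A \<alpha>' (\<theta>'(i := X'))"
        by (auto simp: F_def)
      have "(\<lambda>i. \<theta> i \<union> \<eta> i)(i := X) = (\<lambda>k. (\<theta>(i := X \<inter> A)) k \<union> (\<eta>(i := X \<inter> B)) k)"
        using X(1) by (auto simp: fun_eq_iff)
      moreover have "\<forall>k. (\<eta>(i := X \<inter> B)) k \<subseteq> B"
        using t(6) by auto
      ultimately have "sat (amalgam A B \<alpha>' P) (\<lambda>k. (\<theta>'(i := X')) k \<union> (\<eta>(i := X \<inter> B)) k) \<phi>"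
        using determinesD[OF f(2) upd[OF t(1)] upd[OF t(2) X'(1)] X'(2) t(4,5)] X(2) by simp
      moreover have "(\<lambda>k. (\<theta>'(i := X')) k \<union> (\<eta>(i := X \<inter> B)) k) = (\<lambda>i. \<theta>' i \<union> \<eta> i)(i := X' \<union> (X \<inter> B))"
        by (auto simp: fun_eq_iff)
      ultimately show "sat (amalgam A B \<alpha>' P) (\<lambda>i. \<theta>' i \<union> \<eta> i) (Exists i \<phi>)"
        using X'(1) by (auto simp: amalgam_def intro!: exI[of _ "X' \<union> (X \<inter> B)"])
    qed
  qed simp
qed

section \<open>Sentences and the pigeonhole principle\<close>

lemma sat_cong_free_vars:
  "(\<And>i. i \<in> free_vars \<phi> \<Longrightarrow> \<theta> i = \<theta>' i) \<Longrightarrow> sat H \<theta> \<phi> \<longleftrightarrow> sat H \<theta>' \<phi>"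
proof (induction \<phi> arbitrary: \<theta> \<theta>')
  case (Exists i \<phi>)
  have "sat H (\<theta>(i := X)) \<phi> \<longleftrightarrow> sat H (\<theta>'(i := X)) \<phi>" for X
    using Exists.prems by (intro Exists.IH) auto
  then show ?case by simp
next
  case (Conj \<phi> \<psi>)
  then show ?case by (metis Un_iff free_vars.simps(5) sat.simps(5))
next
  case (Neg \<phi>)
  then show ?case by (metis free_vars.simps(4) sat.simps(4))
qed simp_all

lemma satisfies_sentence_iff:
  assumes "is_sentence \<phi>"
  shows "satisfies H \<phi> \<longleftrightarrow> sat H (\<lambda>i. {}) \<phi>"
proof -
  have "sat H \<theta> \<phi> \<longleftrightarrow> sat H (\<lambda>i. {}) \<phi>" for \<theta>
    using assms by (intro sat_cong_free_vars) (simp add: is_sentence_def)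
  then show ?thesis
    unfolding satisfies_def by (metis empty_subsetI)
qed

text \<open>The order of quantifiers matters: \<open>b\<close> comes from \<open>Q\<close> and
  \<phi> before \<open>A\<close>, \<open>B\<close> and \<alpha>, so the ground set may later be
  chosen according to \<open>b\<close>, and one pair \<open>i\<close>, \<open>j\<close> serves all
  \<open>P\<close>.\<close>

lemma sentence_pigeonhole:
  fixes Q :: "'q set"
  assumes "finite Q" "is_sentence \<phi>"
  shows "\<exists>b. \<forall>A B (\<alpha> :: nat \<Rightarrow> 'e set \<Rightarrow> 'q).
    finite A \<longrightarrow> finite B \<longrightarrow> A \<inter> B = {} \<longrightarrow> (\<forall>i. \<alpha> i ` Pow A \<subseteq> Q) \<longrightarrow>
    (\<exists>i j. i < j \<and> j \<le> b \<and> (\<forall>P. satisfies (amalgam A B (\<alpha> i) P) \<phi> \<longleftrightarrow> satisfies (amalgam A B (\<alpha> j) P) \<phi>))"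
proof -
  obtain code :: "'e set \<Rightarrow> ('e set \<Rightarrow> 'q) \<Rightarrow> (nat \<Rightarrow> 'e set) \<Rightarrow> nat" and b
    where code: "\<And>A \<alpha> \<theta>. typed_assignment Q A \<alpha> \<theta> \<Longrightarrow> code A \<alpha> \<theta> < b" "determines Q code \<phi>"
    using composition[OF assms(1)] assms(2) unfolding is_sentence_def by blast
  show ?thesis
  proof (rule exI[of _ b], intro allI impI)
    fix A B :: "'e set" and \<alpha> :: "nat \<Rightarrow> 'e set \<Rightarrow> 'q"
    assume fin: "finite A" "finite B" "A \<inter> B = {}" and "\<forall>i. \<alpha> i ` Pow A \<subseteq> Q"
    then have t: "typed_assignment Q A (\<alpha> i) (\<lambda>k. {})" for i
      by (simp add: typed_assignment_def)
    let ?c = "\<lambda>i. code A (\<alpha> i) (\<lambda>k. {})"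
    \<comment> \<open>\<open>b + 1\<close> indices share \<open>b\<close> codes.\<close>
    have "?c ` {..b} \<subseteq> {..<b}"
      using code(1)[OF t] by auto
    then have "card (?c ` {..b}) \<le> b"
      using card_mono[of "{..<b}"] by fastforce
    then have "\<not> inj_on ?c {..b}"
      using card_image[of ?c "{..b}"] by auto
    then obtain i j where ij: "i \<le> b" "j \<le> b" "i < j" "?c i = ?c j"
      unfolding inj_on_def by (metis atMost_iff linorder_neqE_nat)
    have "satisfies (amalgam A B (\<alpha> i) P) \<phi> \<longleftrightarrow> satisfies (amalgam A B (\<alpha> j) P) \<phi>" for P
      using determinesD[OF code(2) t t ij(4) fin(2,3), of "\<lambda>k. {}" P]
      by (simp add: satisfies_sentence_iff[OF assms(2)])
    with ij show "\<exists>i j. i < j \<and> j \<le> b \<and>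
        (\<forall>P. satisfies (amalgam A B (\<alpha> i) P) \<phi> \<longleftrightarrow> satisfies (amalgam A B (\<alpha> j) P) \<phi>)"
      by blast
  qed
qed

section \<open>Geodesic words\<close>

context group
begin

text \<open>The ball of radius \<open>n\<close> about \<one> in a Cayley graph, with letters added
  on the left.\<close>

fun word_ball :: "'a set \<Rightarrow> nat \<Rightarrow> 'a set" where
  "word_ball S 0 = {\<one>}"
| "word_ball S (Suc n) = word_ball S n \<union> (\<lambda>(s, x). s \<otimes> x) ` (S \<times> word_ball S n)"

lemma word_ball_carrier:
  assumes "S \<subseteq> carrier G"
  shows "word_ball S n \<subseteq> carrier G"
  using assms by (induction n) auto

lemma word_ball_mono: "m \<le> n \<Longrightarrow> word_ball S m \<subseteq> word_ball S n"
  by (induction n rule: dec_induct) auto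

lemma one_in_word_ball: "\<one> \<in> word_ball S n"
  using word_ball_mono[of 0 n S] by simp

lemma word_ball_card:
  assumes "finite S" "card S \<le> k"
  shows "finite (word_ball S n) \<and> card (word_ball S n) \<le> (k + 1) ^ n"
proof (induction n)
  case (Suc n)
  have "card ((\<lambda>(s, x). s \<otimes> x) ` (S \<times> word_ball S n)) \<le> card S * card (word_ball S n)"
    using assms(1) Suc by (metis card_cartesian_product card_image_le finite_cartesian_product)
  also have "\<dots> \<le> k * card (word_ball S n)"
    using assms(2) by simp
  finally have "card (word_ball S (Suc n)) \<le> card (word_ball S n) + k * card (word_ball S n)"
    by (simp del: split_paired_All) (meson add_left_mono card_Un_le order_trans)
  also have "\<dots> = (k + 1) * card (word_ball S n)"
    by simp
  also have "\<dots> \<le> (k + 1) * (k + 1) ^ n"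
    using Suc by (intro mult_left_mono) auto
  finally show ?case
    using Suc assms(1) by simp
qed simp

text \<open>A ball that stops growing is closed under left multiplication by the letters, hence by
  everything they generate; applied to \<one> this catches every generated element.\<close>

lemma generate_subset_stable_ball:
  assumes "A \<subseteq> carrier G" "S = (A \<union> m_inv G ` A) - {\<one>}" "word_ball S (Suc n) = word_ball S n"
  shows "generate G A \<subseteq> word_ball S n"
proof -
  have S: "S \<subseteq> carrier G" using assms(1,2) by auto
  have step: "s \<otimes> x \<in> word_ball S n" if "s \<in> A \<union> m_inv G ` A" "x \<in> word_ball S n" for s x
  \<comment> \<open>Dropping \<one> from \<open>S\<close> loses nothing, as multiplying by it
    changes nothing.\<close>
  proof (cases "s = \<one>")
    case True
    then show ?thesis using that(2) word_ball_carrier[OF S, of n] by (simp add: subset_iff)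
  next
    case False
    then have "s \<otimes> x \<in> word_ball S (Suc n)"
      using that assms(2) by auto
    then show ?thesis unfolding assms(3) .
  qed
  have "\<forall>x \<in> word_ball S n. h \<otimes> x \<in> word_ball S n" if "h \<in> generate G A" for h
    using that
  proof (induction rule: generate.induct)
    case one
    then show ?case using word_ball_carrier[OF S, of n] by (simp add: subset_iff)
  next
    case (incl h)
    then show ?case using step by auto
  next
    case (inv h)
    then show ?case using step by auto
  next
    case (eng h1 h2)
    have "h1 \<in> carrier G" "h2 \<in> carrier G"
      using eng.hyps assms(1) generate_in_carrier by auto
    then show ?case
      using eng.IH word_ball_carrier[OF S] by (metis m_assoc subsetD)
  qed
  then show ?thesis
    using one_in_word_ball[of S n] generate_in_carrier[OF assms(1)] by force
qed

text \<open>Peel off the leftmost letter: if \<open>s \<otimes> y\<close> first occurs at radius n +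
  1, then \<open>y\<close> first occurs at radius n.\<close>

lemma geodesic_to_sphere:
  assumes "S \<subseteq> carrier G" "x \<in> word_ball S n" "\<forall>m < n. x \<notin> word_ball S m"
  shows "\<exists>w. w 0 = \<one> \<and> w n = x \<and> (\<forall>t < n. \<exists>s \<in> S. w (Suc t) = s \<otimes> w t) \<and>
           (\<forall>t \<le> n. w t \<in> word_ball S t \<and> (\<forall>m < t. w t \<notin> word_ball S m))"
  using assms(2,3)
proof (induction n arbitrary: x)
  case 0
  then show ?case by (intro exI[of _ "\<lambda>_. \<one>"]) auto
next
  case (Suc n)
  then obtain s y where sy: "s \<in> S" "y \<in> word_ball S n" "x = s \<otimes> y"
    by auto
  have "y \<notin> word_ball S m" if "m < n" for m
  proof
    assume "y \<in> word_ball S m"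
    then have "x \<in> word_ball S (Suc m)" using sy by auto
    then show False using Suc.prems(2) that Suc_mono by blast
  qed
  then obtain w where w: "w 0 = \<one>" "w n = y" "\<forall>t < n. \<exists>s \<in> S. w (Suc t) = s \<otimes> w t"
    "\<forall>t \<le> n. w t \<in> word_ball S t \<and> (\<forall>m < t. w t \<notin> word_ball S m)"
    using Suc.IH[OF sy(2)] by auto
  show ?case
    using w sy Suc.prems
    by (intro exI[of _ "w(Suc n := x)"]) (auto simp: less_Suc_eq le_Suc_eq)
qed

text \<open>For a suitable fixed number of generators the generated subgroups are unbounded in size,
  whereas a ball of radius \<open>N\<close> is bounded. So the balls can be made to grow up to
  radius \<open>N\<close>, and some element has distance exactly \<open>N\<close>. The stages of a
  geodesic to it have distances 0, ..., N, which separates them from each other and, from distance 2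
  on, from \<one> and the letters.\<close>

lemma long_geodesic_words:
  assumes "\<not> uniformly_locally_finite G"
  shows "\<exists>k. \<forall>N. \<exists>S w. S \<subseteq> carrier G \<and> finite S \<and> card S \<le> k \<and> \<one> \<notin> S \<and> w 0 = \<one> \<and>
    (\<forall>t < N. \<exists>s \<in> S. w (Suc t) = s \<otimes> w t) \<and> w ` {..N} \<subseteq> carrier G \<and> inj_on w {..N} \<and>
    (\<forall>t. 2 \<le> t \<and> t \<le> N \<longrightarrow> w t \<notin> insert \<one> S)"
proof -
  have "\<exists>k. \<forall>n. \<exists>A. A \<subseteq> carrier G \<and> finite A \<and> card A \<le> k \<and>
      \<not> (finite (generate G A) \<and> card (generate G A) \<le> n)"
  proof (rule ccontr)
    assume "\<not> ?thesis"
    then have "\<forall>k. \<exists>n. \<forall>A. card A \<le> k \<longrightarrow> finite A \<longrightarrow> A \<subseteq> carrier G \<longrightarrow>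
        finite (generate G A) \<and> card (generate G A) \<le> n"
      by simp
    then obtain g where g: "\<And>k A. card A \<le> k \<longrightarrow> finite A \<longrightarrow> A \<subseteq> carrier G \<longrightarrow>
        finite (generate G A) \<and> card (generate G A) \<le> g k"
      by metis
    have "uniformly_locally_finite G"
      unfolding uniformly_locally_finite_def
    \<comment> \<open>The bounding function has to be positive, whence
      \<open>g k + 1\<close>.\<close>
    proof (intro exI[of _ "\<lambda>k. g k + 1"] conjI allI impI)
      fix k A
      assume "A \<subseteq> carrier G \<and> finite A \<and> card A \<le> k"
      with g show "finite (generate G A)" "card (generate G A) \<le> g k + 1"
        by (blast, meson le_SucI add_increasing2 le_add1 order_trans)
    qed simp
    then show False using assms by blast
  qed
  then obtain k where k: "\<And>n. \<exists>A. A \<subseteq> carrier G \<and> finite A \<and> card A \<le> k \<and>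
      \<not> (finite (generate G A) \<and> card (generate G A) \<le> n)"
    by blast
  show ?thesis
  \<comment> \<open>Adding inverses at most doubles the number of letters.\<close>
  proof (rule exI[of _ "2 * k"], rule allI)
    fix N
    \<comment> \<open>The threshold is the bound of \<open>word_ball_card\<close> for
      \<open>2 * k\<close> letters and radius \<open>N\<close>.\<close>
    obtain A where A: "A \<subseteq> carrier G" "finite A" "card A \<le> k"
      "\<not> (finite (generate G A) \<and> card (generate G A) \<le> (2 * k + 1) ^ N)"
      using k by blast
    define S where "S = (A \<union> m_inv G ` A) - {\<one>}"
    have S: "S \<subseteq> carrier G" "finite S" "\<one> \<notin> S"
      using A by (auto simp: S_def)
    have "card S \<le> card (A \<union> m_inv G ` A)"
      using A(2) by (auto simp: S_def intro!: card_mono)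
    also have "\<dots> \<le> card A + card (m_inv G ` A)"
      by (rule card_Un_le)
    also have "\<dots> \<le> 2 * k"
      using A(3) card_image_le[OF A(2), of "m_inv G"] by linarith
    finally have cS: "card S \<le> 2 * k" .
    have grow: "word_ball S (Suc n) \<noteq> word_ball S n" if "n < N" for n
    proof
      assume "word_ball S (Suc n) = word_ball S n"
      then have "generate G A \<subseteq> word_ball S N"
        using generate_subset_stable_ball[OF A(1) S_def] word_ball_mono[of n N S] that by auto
      then show False
        using A(4) word_ball_card[OF S(2) cS, of N] by (meson card_mono finite_subset order_trans)
    qed
    have "\<exists>x. x \<in> word_ball S N \<and> (\<forall>m < N. x \<notin> word_ball S m)"
    proof (cases N)
      case 0
      then show ?thesis by auto
    next
      case (Suc n)
      then obtain x where "x \<in> word_ball S N" "x \<notin> word_ball S n"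
        using grow[of n] word_ball_mono[of n N S] by auto
      then show ?thesis
        using word_ball_mono[of _ n S] Suc by (meson less_Suc_eq_le subsetD)
    qed
    then obtain w where w: "w 0 = \<one>" "\<forall>t < N. \<exists>s \<in> S. w (Suc t) = s \<otimes> w t"
      "\<And>t. t \<le> N \<Longrightarrow> w t \<in> word_ball S t" "\<And>t m. t \<le> N \<Longrightarrow> m < t \<Longrightarrow> w t \<notin> word_ball S m"
      using geodesic_to_sphere[OF S(1)] by metis
    have "w ` {..N} \<subseteq> carrier G"
      using w(3) word_ball_carrier[OF S(1)] by auto
    moreover have "inj_on w {..N}"
      using w(3,4) by (metis (mono_tags, lifting) atMost_iff inj_onI linorder_neqE_nat)
    moreover have ball1: "insert \<one> S \<subseteq> word_ball S 1"
      using S(1) by (auto simp: image_iff) (metis r_one subsetD)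
    have "\<forall>t. 2 \<le> t \<and> t \<le> N \<longrightarrow> w t \<notin> insert \<one> S"
    proof (intro allI impI)
      fix t assume "2 \<le> t \<and> t \<le> N"
      then have "w t \<notin> word_ball S 1"
        by (intro w(4)) auto
      then show "w t \<notin> insert \<one> S"
        using ball1 by blast
    qed
    ultimately show "\<exists>S w. S \<subseteq> carrier G \<and> finite S \<and> card S \<le> 2 * k \<and> \<one> \<notin> S \<and> w 0 = \<one> \<and>
      (\<forall>t < N. \<exists>s \<in> S. w (Suc t) = s \<otimes> w t) \<and> w ` {..N} \<subseteq> carrier G \<and> inj_on w {..N} \<and>
      (\<forall>t. 2 \<le> t \<and> t \<le> N \<longrightarrow> w t \<notin> insert \<one> S)"
      using S cS w(1,2) by blast
  qed
qed

end

section \<open>The amalgams\<close>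

text \<open>\<open>Joint v\<close> is a loop at \<open>v\<close>, and \<open>Edge\<close> constructors are named after the vertices joined. The
  boolean selects the left (\<open>False\<close>) or the right half; the numbers index the gains.\<close>

datatype point = Joint nat | Edge01 nat | Edge02 bool nat | Edge12 bool nat

text \<open>Countability embeds the points into any infinite type of matroid elements.\<close>

instance point :: countable
  by countable_datatype

primrec pt_ends :: "point \<Rightarrow> nat set" where
  "pt_ends (Joint v) = {v}"
| "pt_ends (Edge01 c) = {0, 1}"
| "pt_ends (Edge02 s t) = {0, 2}"
| "pt_ends (Edge12 s t) = {1, 2}"

text \<open>\<open>a\<close> lists the letters, \<open>w t\<close> is the stage after
  \<open>t\<close> of them, and \<open>r t\<close> is the index of the letter added next. By
  \<open>w_new\<close> the gain \<open>w i\<close> of the variable edge 01 differs from all other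
  gains of edges 01 once 2 \<le> i.\<close>

locale word_matroid = group G for G (structure) +
  fixes m N :: nat and a w :: "nat \<Rightarrow> 'a" and r :: "nat \<Rightarrow> nat" and \<iota> :: "point \<Rightarrow> 'e"
  assumes N_ge_2: "2 \<le> N"
    and a_carrier: "i < m \<Longrightarrow> a i \<in> carrier G"
    and a_inj: "inj_on a {..<m}"
    and a_not_one: "i < m \<Longrightarrow> a i \<noteq> \<one>"
    and w_0: "w 0 = \<one>"
    and r_less: "t < N \<Longrightarrow> r t < m"
    and w_Suc: "t < N \<Longrightarrow> w (Suc t) = a (r t) \<otimes> w t"
    and w_inj: "inj_on w {..N}"
    and w_new: "2 \<le> t \<Longrightarrow> t \<le> N \<Longrightarrow> w t \<notin> insert \<one> (a ` {..<m})"
    and \<iota>_inj: "inj \<iota>"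
begin

text \<open>The letters are shifted by one to leave index 0 to the gain \<one>. Among the indices up
  to \<open>Suc m\<close> only the last depends on \<open>i\<close>.\<close>

definition base_gain :: "nat \<Rightarrow> nat \<Rightarrow> 'a" where
  "base_gain i c = (if c = 0 then \<one> else if c \<le> m then a (c - 1) else w i)"

definition triangle :: "nat \<Rightarrow> nat \<Rightarrow> nat \<Rightarrow> nat \<Rightarrow> bool" where
  "triangle i c u t \<longleftrightarrow> c \<le> Suc m \<and> u \<le> N \<and> t \<le> N \<and> base_gain i c \<otimes> w u = w t"

definition points :: "point set" where
  "points = Joint ` {..2} \<union> Edge01 ` {..Suc m} \<union> (\<lambda>(s, t). Edge02 s t) ` (UNIV \<times> {..N}) \<union>
     (\<lambda>(s, t). Edge12 s t) ` (UNIV \<times> {..N})"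

definition lab :: "'e \<Rightarrow> point" where
  "lab = the_inv \<iota>"

definition span :: "'e set \<Rightarrow> nat set" where
  "span Z = (\<Union>e \<in> Z. pt_ends (lab e))"

definition tri_set :: "bool \<Rightarrow> nat \<Rightarrow> nat \<Rightarrow> nat \<Rightarrow> 'e set" where
  "tri_set s c u t = {\<iota> (Edge01 c), \<iota> (Edge12 s u), \<iota> (Edge02 s t)}"

text \<open>The criterion \<open>frame_independent_iff\<close> for the intended graph, with
  prescribed balanced triangles in place of a gaining. Half \<open>s\<close> treats the last edge 01
  as having gain \<open>w (k s)\<close>, and the two halves may disagree about it.\<close>

definition amalgamated :: "(bool \<Rightarrow> nat) \<Rightarrow> 'e hypergraph" where
  "amalgamated k = (\<iota> ` points, {Z. Z \<subseteq> \<iota> ` points \<and> (\<forall>Y \<subseteq> Z. card Y \<le> card (span Y)) \<and>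
     (\<forall>s c u t. triangle (k s) c u t \<longrightarrow> \<not> tri_set s c u t \<subseteq> Z)})"

lemma lab_\<iota> [simp]: "lab (\<iota> p) = p"
  by (simp add: lab_def the_inv_f_f \<iota>_inj)

lemma \<iota>_eq [simp]: "\<iota> p = \<iota> q \<longleftrightarrow> p = q"
  using \<iota>_inj by (simp add: inj_eq)

lemma \<iota>_mem [simp]: "\<iota> p \<in> \<iota> ` X \<longleftrightarrow> p \<in> X"
  using \<iota>_inj by (simp add: inj_image_mem_iff)

lemma points_iff [simp]:
  "Joint v \<in> points \<longleftrightarrow> v \<le> 2" "Edge01 c \<in> points \<longleftrightarrow> c \<le> Suc m"
  "Edge02 s t \<in> points \<longleftrightarrow> t \<le> N" "Edge12 s t \<in> points \<longleftrightarrow> t \<le> N"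
  by (auto simp: points_def)

lemma finite_points: "finite points"
  by (simp add: points_def)

section \<open>Gains that realise the diagonal amalgams\<close>

lemma w_carrier: "t \<le> N \<Longrightarrow> w t \<in> carrier G"
proof (induction t)
  case (Suc t)
  then show ?case using w_Suc[of t] a_carrier r_less[of t] by simp
qed (simp add: w_0)

lemma base_gain_carrier: "i \<le> N \<Longrightarrow> c \<le> Suc m \<Longrightarrow> base_gain i c \<in> carrier G"
  by (auto simp: base_gain_def a_carrier w_carrier)

text \<open>This rules out balanced digons among the edges 01. For i < 2 the last gain would repeat
  an earlier one.\<close>

lemma base_gain_inj:
  assumes "2 \<le> i" "i \<le> N"
  shows "inj_on (base_gain i) {..Suc m}"
proof (rule inj_onI)
  fix c d assume cd: "c \<in> {..Suc m}" "d \<in> {..Suc m}" "base_gain i c = base_gain i d"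
  have a_eq: "c = d" if "a (c - 1) = a (d - 1)" "0 < c" "0 < d" "c \<le> m" "d \<le> m" for c d
  proof -
    have "c - 1 < m" "d - 1 < m" using that by auto
    then have "c - 1 = d - 1" using inj_onD[OF a_inj that(1)] by simp
    then show ?thesis using that by simp
  qed
  have w_ne: "w i \<noteq> a (c - 1) \<and> a (c - 1) \<noteq> w i" if "0 < c" "c \<le> m" for c
    using w_new[OF assms] that by (auto simp: image_iff) (metis Suc_le_eq Suc_pred lessThan_iff)
  have a_ne: "0 < c \<Longrightarrow> c \<le> m \<Longrightarrow> a (c - 1) \<noteq> \<one>" for c
    using a_not_one[of "c - 1"] by simp
  show "c = d"
    using cd a_eq[of c d] w_ne[of c] w_ne[of d] w_new[OF assms] a_ne[of c] a_ne[of d]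
    by (auto simp: base_gain_def split: if_splits)
qed

text \<open>Each forbidden coincidence has a single solution \<open>h\<close>, there are finitely
  many of them, and the group is infinite. Translating one half by \<open>h\<close> keeps edges 12
  and 02 of different halves out of a common balanced triangle.\<close>

lemma generic_translate:
  assumes "infinite (carrier G)" "i \<le> N"
  obtains h where "h \<in> carrier G"
    "\<And>c u t. c \<le> Suc m \<Longrightarrow> u \<le> N \<Longrightarrow> t \<le> N \<Longrightarrow> base_gain i c \<otimes> (w u \<otimes> h) \<noteq> w t"
    "\<And>c u t. c \<le> Suc m \<Longrightarrow> u \<le> N \<Longrightarrow> t \<le> N \<Longrightarrow> base_gain i c \<otimes> w u \<noteq> w t \<otimes> h"
proof -
  let ?I = "{..Suc m} \<times> {..N} \<times> {..N}"
  let ?F = "(\<lambda>(c, u, t). inv (base_gain i c \<otimes> w u) \<otimes> w t) ` ?I \<union>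
    (\<lambda>(c, u, t). inv (w t) \<otimes> (base_gain i c \<otimes> w u)) ` ?I"
  have "finite ?F" by auto
  then obtain h where h: "h \<in> carrier G" "h \<notin> ?F"
    using assms(1) by (meson finite_subset subsetI)
  show thesis
  proof (rule that[OF h(1)])
    fix c u t assume le: "c \<le> Suc m" "u \<le> N" "t \<le> N"
    have car: "base_gain i c \<in> carrier G" "w u \<in> carrier G" "w t \<in> carrier G"
      using le assms(2) by (simp_all add: base_gain_carrier w_carrier)
    have "h \<noteq> inv (base_gain i c \<otimes> w u) \<otimes> w t"
      using h(2) le by (force simp: image_iff)
    then show "base_gain i c \<otimes> (w u \<otimes> h) \<noteq> w t"
      using car h(1) by (metis inv_solve_left m_assoc m_closed)
    have "h \<noteq> inv (w t) \<otimes> (base_gain i c \<otimes> w u)"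
      using h(2) le by (force simp: image_iff)
    then show "base_gain i c \<otimes> w u \<noteq> w t \<otimes> h"
      using car h(1) by (metis inv_solve_left m_closed)
  qed
qed

lemma pt_ends_eq:
  "pt_ends p = {0, 1} \<Longrightarrow> \<exists>c. p = Edge01 c"
  "pt_ends p = {0, 2} \<Longrightarrow> \<exists>s t. p = Edge02 s t"
  "pt_ends p = {1, 2} \<Longrightarrow> \<exists>s t. p = Edge12 s t"
  by (cases p; auto simp: doubleton_eq_iff)+

lemma span_le_3: "Z \<subseteq> \<iota> ` points \<Longrightarrow> span Z \<subseteq> {0, 1, 2}"
  by (auto simp: span_def points_def)

text \<open>When both halves agree on \<open>i\<close>, the group supplies the gains: those of the
  right half are multiplied on the right by a generic \<open>h\<close>, and the balanced cycles are
  then exactly the prescribed triangles.\<close>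

lemma diagonal_gain_graphic:
  assumes "infinite (carrier G)" "2 \<le> i" "i \<le> N"
  shows "amalgamated (\<lambda>_. i) \<in> gain_graphic_matroids G"
proof -
  obtain h where h: "h \<in> carrier G"
    "\<And>c u t. c \<le> Suc m \<Longrightarrow> u \<le> N \<Longrightarrow> t \<le> N \<Longrightarrow> base_gain i c \<otimes> (w u \<otimes> h) \<noteq> w t"
    "\<And>c u t. c \<le> Suc m \<Longrightarrow> u \<le> N \<Longrightarrow> t \<le> N \<Longrightarrow> base_gain i c \<otimes> w u \<noteq> w t \<otimes> h"
    using generic_translate[OF assms(1,3)] by metis
  define hs where "hs s = (if s then h else \<one>)" for s
  have hs: "hs s \<in> carrier G" for s using h(1) by (simp add: hs_def)
  \<comment> \<open>The loops only have to be unbalanced, and \<open>a 0\<close> is not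
    \<one>.\<close>
  define pgain where "pgain p = (case p of Joint _ \<Rightarrow> a 0 | Edge01 c \<Rightarrow> base_gain i c
    | Edge02 s t \<Rightarrow> w t \<otimes> hs s | Edge12 s t \<Rightarrow> w t \<otimes> hs s)" for p
  have m0: "0 < m" using r_less[of 0] N_ge_2 by linarith
  have pgain: "pgain p \<in> carrier G" if "p \<in> points" for p
    using that m0 a_carrier hs base_gain_carrier[OF assms(3)] w_carrier
    by (cases p) (auto simp: pgain_def)
  \<comment> \<open>Within one half the right factors cancel; mixed halves are excluded by the
    choice of \<open>h\<close>.\<close>
  have side: "s = s' \<and> base_gain i c \<otimes> w u = w t"
    if "base_gain i c \<otimes> (w u \<otimes> hs s) = w t \<otimes> hs s'" "c \<le> Suc m" "u \<le> N" "t \<le> N" for c u t s s'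
  proof -
    have car: "base_gain i c \<in> carrier G" "w u \<in> carrier G" "w t \<in> carrier G"
      using that assms(3) by (simp_all add: base_gain_carrier w_carrier)
    have "s = s'"
      using that(1) h(2,3)[OF that(2-4)] car by (cases s; cases s') (auto simp: hs_def)
    moreover have "(base_gain i c \<otimes> w u) \<otimes> hs s = w t \<otimes> hs s'"
      using that(1) car hs by (simp add: m_assoc)
    ultimately show ?thesis using car hs right_cancel[of "hs s" "base_gain i c \<otimes> w u" "w t"] by simp
  qed
  let ?G = "\<lparr>verts = {0, 1, 2}, edges = \<iota> ` points, ends = \<lambda>e. pt_ends (lab e)\<rparr> :: (nat, 'e) graph"
  \<comment> \<open>Gains are read from the smaller to the larger vertex; loops fall under the first
    branch.\<close>
  define \<sigma> :: "'e \<Rightarrow> nat \<Rightarrow> nat \<Rightarrow> 'a" where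
    "\<sigma> e x y = (if x \<le> y then pgain (lab e) else inv (pgain (lab e)))" for e x y
  have "\<exists>u \<in> {0, 1, 2}. \<exists>v \<in> {0, 1, 2}. pt_ends p = {u, v}" if "p \<in> points" for p
    using that by (cases p) (auto simp: numeral_2_eq_2 le_Suc_eq)
  then have graph: "is_graph ?G"
    using finite_points by (auto simp: is_graph_def)
  have gaining: "is_gaining G ?G \<sigma>"
    using pgain by (auto simp: is_gaining_def \<sigma>_def)
  have bal: "balanced_cycles G ?G \<sigma> = {tri_set s c u t | s c u t. triangle i c u t}" (is "?B = ?T")
  proof
    show "?T \<subseteq> ?B"
    proof clarify
      fix s c u t assume tri: "triangle i c u t"
      then have le: "c \<le> Suc m" "u \<le> N" "t \<le> N" "base_gain i c \<otimes> w u = w t"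
        by (auto simp: triangle_def)
      have "base_gain i c \<otimes> (w u \<otimes> hs s) = w t \<otimes> hs s"
        using le assms(3) hs by (simp add: base_gain_carrier w_carrier m_assoc[symmetric])
      then show "tri_set s c u t \<in> ?B"
        unfolding tri_set_def using le
        by (subst triangle_balanced_iff[OF is_group graph gaining, where x = 0 and y = 1 and z = 2])
          (auto simp: \<sigma>_def pgain_def)
    qed
    show "?B \<subseteq> ?T"
    proof
      fix C assume C: "C \<in> ?B"
      \<comment> \<open>A cycle visits each of the three vertices at most once.\<close>
      have "card C \<le> 3"
      proof -
        obtain vs es where t: "C = set es" "traverses_cycle ?G vs es"
          using C unfolding balanced_cycles_def by blast
        then have *: "length vs = Suc (length es)" "distinct (tl vs)" "set (tl vs) \<subseteq> {0, 1, 2}"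
          by (auto simp: traverses_cycle_def is_walk_def dest: list.set_sel(2)[rotated])
        have "card C \<le> length es"
          unfolding t(1) by (rule card_length)
        also have "length es = card (set (tl vs))"
          using *(1) distinct_card[OF *(2)] by simp
        also have "\<dots> \<le> card {0, 1, 2 :: nat}"
          using *(3) by (rule card_mono[rotated]) simp
        finally show ?thesis by simp
      qed
      note sub = balanced_cycle_card_le_3(1)[OF is_group gaining C this]
      have I: "C \<in> ?T" if eq: "C = {e, f, g}" and ends: "pt_ends (lab e) = {0, 1}"
        "pt_ends (lab f) = {1, 2}" "pt_ends (lab g) = {0, 2}" for e f g
      proof -
        obtain c where e: "e = \<iota> (Edge01 c)" "c \<le> Suc m"
          using pt_ends_eq(1)[OF ends(1)] sub eq by auto
        obtain s u where f: "f = \<iota> (Edge12 s u)" "u \<le> N"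
          using pt_ends_eq(3)[OF ends(2)] sub eq by auto
        obtain s' t where g: "g = \<iota> (Edge02 s' t)" "t \<le> N"
          using pt_ends_eq(2)[OF ends(3)] sub eq by auto
        have "\<sigma> e 0 1 \<otimes> \<sigma> f 1 2 = \<sigma> g 0 2"
          using C e f g unfolding eq
          by (subst (asm) triangle_balanced_iff[OF is_group graph gaining, where x = 0 and y = 1 and z = 2]) auto
        then have "base_gain i c \<otimes> (w u \<otimes> hs s) = w t \<otimes> hs s'"
          using e f g by (simp add: \<sigma>_def pgain_def)
        then have "s = s'" "triangle i c u t"
          using side e(2) f(2) g(2) by (auto simp: triangle_def)
        then show ?thesis
          using eq e f g unfolding tri_set_def by blast
      qed
      from balanced_cycle_card_le_3(2)[OF is_group gaining C \<open>card C \<le> 3\<close>] show "C \<in> ?T"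
      proof (elim disjE exE conjE)
        fix x e assume e: "C = {e}" "ends ?G e = {x}" "\<sigma> e x x = \<one>"
        then obtain v where "lab e = Joint v"
          by (cases "lab e") auto
        then show ?thesis
          using e(3) a_not_one[OF m0] by (simp add: \<sigma>_def pgain_def)
      next
        fix x y e f assume ef: "C = {e, f}" "e \<noteq> f" "x \<noteq> y" "ends ?G e = {x, y}" "ends ?G f = {x, y}"
        obtain p q where pq: "e = \<iota> p" "f = \<iota> q" "p \<in> points" "q \<in> points"
          using sub ef(1) by auto
        have "\<sigma> e x y = \<sigma> f x y"
          using digon_balanced_iff[OF is_group graph gaining _ _ ef(2,4,5,3)] C sub ef(1) by simp
        then have gain_eq: "pgain p = pgain q"
          using pq pgain by (auto simp: \<sigma>_def split: if_splits) (metis inv_inv)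
        have ends_eq: "pt_ends p = {x, y}" "pt_ends q = {x, y}"
          using ef(4,5) pq by auto
        have "p = q"
        proof (cases p)
          case (Joint v)
          then show ?thesis using ends_eq ef(3) by auto
        next
          case (Edge01 c)
          then obtain d where "q = Edge01 d" using ends_eq pt_ends_eq(1)[of q] by auto
          then show ?thesis
            using gain_eq pq Edge01 inj_onD[OF base_gain_inj[OF assms(2,3)], of c d] by (simp add: pgain_def)
        next
          case (Edge02 s t)
          then obtain s' t' where q: "q = Edge02 s' t'" using ends_eq pt_ends_eq(2)[of q] by auto
          \<comment> \<open>Since \<open>base_gain i 0\<close> is \<one>, the case
            \<open>c = 0\<close> of \<open>side\<close> also separates parallel edges.\<close>
          have "base_gain i 0 \<otimes> (w t \<otimes> hs s) = w t' \<otimes> hs s'"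
            using gain_eq pq Edge02 q hs w_carrier by (simp add: pgain_def base_gain_def)
          then have "s = s'" "w t = w t'"
            using side[of 0 t s t' s'] pq Edge02 q w_carrier by (auto simp: base_gain_def)
          then show ?thesis using inj_onD[OF w_inj, of t t'] pq Edge02 q by simp
        next
          case (Edge12 s t)
          then obtain s' t' where q: "q = Edge12 s' t'" using ends_eq pt_ends_eq(3)[of q] by auto
          have "base_gain i 0 \<otimes> (w t \<otimes> hs s) = w t' \<otimes> hs s'"
            using gain_eq pq Edge12 q hs w_carrier by (simp add: pgain_def base_gain_def)
          then have "s = s'" "w t = w t'"
            using side[of 0 t s t' s'] pq Edge12 q w_carrier by (auto simp: base_gain_def)
          then show ?thesis using inj_onD[OF w_inj, of t t'] pq Edge12 q by simp
        qed
        then show ?thesis using ef(2) pq by simp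
      next
        fix x y z e f g assume *: "C = {e, f, g}" "distinct [x, y, z]" "ends ?G e = {x, y}"
          "ends ?G f = {y, z}" "ends ?G g = {z, x}"
        have "span {e, f, g} \<subseteq> {0, 1, 2}"
          using sub *(1) by (intro span_le_3) simp
        then have "x \<in> {0, 1, 2}" "y \<in> {0, 1, 2}" "z \<in> {0, 1, 2}"
          using *(3-5) by (auto simp: span_def)
        then consider "x = 0" "y = 1" "z = 2" | "x = 0" "y = 2" "z = 1" | "x = 1" "y = 0" "z = 2"
          | "x = 1" "y = 2" "z = 0" | "x = 2" "y = 0" "z = 1" | "x = 2" "y = 1" "z = 0"
          using *(2) by auto
        then show ?thesis
        proof cases
          case 1
          then show ?thesis using * by (intro I[of e f g]) auto
        next
          case 2
          then show ?thesis using * by (intro I[of g f e]) auto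
        next
          case 3
          then show ?thesis using * by (intro I[of e g f]) auto
        next
          case 4
          then show ?thesis using * by (intro I[of g e f]) auto
        next
          case 5
          then show ?thesis using * by (intro I[of f g e]) auto
        next
          case 6
          then show ?thesis using * by (intro I[of f e g]) auto
        qed
      qed
    qed
  qed
  have "X \<in> snd (frame_matroid G ?G \<sigma>) \<longleftrightarrow> X \<in> snd (amalgamated (\<lambda>_. i))" for X
    unfolding frame_independent_iff[OF graph] bal
    by (auto simp: amalgamated_def covered_def span_def) blast
  then have "snd (frame_matroid G ?G \<sigma>) = snd (amalgamated (\<lambda>_. i))"
    by blast
  moreover have "fst (frame_matroid G ?G \<sigma>) = fst (amalgamated (\<lambda>_. i))"
    by (simp add: frame_matroid_def amalgamated_def)
  ultimately have "frame_matroid G ?G \<sigma> = amalgamated (\<lambda>_. i)"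
    by (rule prod_eqI[rotated])
  then show ?thesis
    unfolding gain_graphic_matroids_def using graph gaining by (metis (mono_tags, lifting) mem_Collect_eq)
qed

section \<open>Rigidity of gain-graphic amalgams\<close>

lemma indep_pair:
  assumes "p \<in> points" "q \<in> points"
  shows "{\<iota> p, \<iota> q} \<in> snd (amalgamated k)"
proof -
  have nonempty: "1 \<le> card (pt_ends p)" for p
    by (cases p) auto
  have two: "2 \<le> card (pt_ends p \<union> pt_ends q)" if "p \<noteq> q"
    using that by (cases p; cases q) (auto simp: card_insert_if)
  have "card Y \<le> card (span Y)" if "Y \<subseteq> {\<iota> p, \<iota> q}" for Y
  proof -
    have "Y = {} \<or> Y = {\<iota> p} \<or> Y = {\<iota> q} \<or> Y = {\<iota> p, \<iota> q}"
      using that by auto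
    then show ?thesis
      using nonempty two by (cases "p = q") (auto simp: span_def)
  qed
  moreover have "\<not> tri_set s c u t \<subseteq> {\<iota> p, \<iota> q}" for s c u t
    by (auto simp: tri_set_def)
  ultimately show ?thesis
    using assms by (simp add: amalgamated_def)
qed

lemma indep_joints: "{\<iota> (Joint 0), \<iota> (Joint 1), \<iota> (Joint 2)} \<in> snd (amalgamated k)"
proof -
  have "card Y \<le> card (span Y)" if Y: "Y \<subseteq> (\<iota> \<circ> Joint) ` {0, 1, 2}" for Y
  proof -
    obtain U where U: "Y = (\<iota> \<circ> Joint) ` U"
      using Y by (meson subset_imageE)
    moreover have "inj_on (\<iota> \<circ> Joint) U" by (auto simp: inj_on_def)
    ultimately have "card Y = card U" by (metis card_image)
    moreover have "span Y = U" by (auto simp: span_def U)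
    ultimately show ?thesis by simp
  qed
  moreover have "\<not> tri_set s c u t \<subseteq> (\<iota> \<circ> Joint) ` {0, 1, 2}" for s c u t
    by (auto simp: tri_set_def)
  ultimately show ?thesis
    by (simp add: amalgamated_def)
qed

text \<open>Lines with four points force the shape of the graph. Gains normalised by
  \<open>\<beta> 0\<close> make both halves spell the same word \<open>W\<close>, and the last edge
  01 has to match stage \<open>k False\<close> as well as stage \<open>k True\<close> of it. Were
  these indices different, two parallel edges would form a balanced digon.\<close>

lemma gain_graphic_imp_diagonal:
  assumes "amalgamated k \<in> gain_graphic_matroids G" "\<And>s. k s \<le> N"
  shows "k False = k True"
proof -
  obtain H :: "(nat, 'e) graph" and \<sigma> where graph: "is_graph H" and gaining: "is_gaining G H \<sigma>"
    and eq: "frame_matroid G H \<sigma> = amalgamated k"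
    using assms(1) unfolding gain_graphic_matroids_def by (smt (verit) mem_Collect_eq)
  interpret gg: gain_graph G H \<sigma>
    using graph gaining is_group by unfold_locales
  have edges: "edges H = \<iota> ` points"
    using eq by (simp add: frame_matroid_def amalgamated_def)
  \<comment> \<open>One side of the intended triangle, including the joints at its two ends.\<close>
  define L where "L x y = \<iota> ` {p \<in> points. pt_ends p \<subseteq> {x, y}}" for x y
  have line: "gg.line (L x y)" for x y
    unfolding gg.line_def
  proof (intro conjI ballI impI)
    show "L x y \<subseteq> edges H" by (auto simp: L_def edges)
    show "gg.indep {e, f}" if "e \<in> L x y" "f \<in> L x y" for e f
      using that indep_pair unfolding eq L_def by auto
    show "\<not> gg.indep {e, f, g}" if efg: "e \<in> L x y" "f \<in> L x y" "g \<in> L x y" "distinct [e, f, g]" for e f g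
    proof
      assume "gg.indep {e, f, g}"
      then have "card {e, f, g} \<le> card (span {e, f, g})"
        unfolding eq amalgamated_def by (simp del: card_insert_disjoint)
      moreover have "span {e, f, g} \<subseteq> {x, y}"
        using efg by (auto simp: span_def L_def)
      then have "card (span {e, f, g}) \<le> card {x, y}"
        by (rule card_mono[rotated]) simp
      moreover have "card {x, y} \<le> 2" "card {e, f, g} = 3"
        using efg(4) by (simp_all add: card_insert_if)
      ultimately show False by linarith
    qed
  qed
  \<comment> \<open>Besides its two joints each line offers two links: indices 0 and 1 on 01, and
    one edge from each half on 02 and 12.\<close>
  obtain x0 x1 x2 where dist: "distinct [x0, x1, x2]"
    and ends: "\<And>e. e \<in> L 0 1 - {\<iota> (Joint 0), \<iota> (Joint 1)} \<Longrightarrow> ends H e = {x0, x1}"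
      "\<And>e. e \<in> L 0 2 - {\<iota> (Joint 0), \<iota> (Joint 2)} \<Longrightarrow> ends H e = {x0, x2}"
      "\<And>e. e \<in> L 1 2 - {\<iota> (Joint 1), \<iota> (Joint 2)} \<Longrightarrow> ends H e = {x1, x2}"
    by (rule gg.triangle_of_lines[of "L 0 1" "L 0 2" "L 1 2" "\<iota> (Joint 0)" "\<iota> (Joint 1)" "\<iota> (Edge01 0)"
          "\<iota> (Edge01 1)" "\<iota> (Joint 2)" "\<iota> (Edge02 False 0)" "\<iota> (Edge02 True 0)"
          "\<iota> (Edge12 False 0)" "\<iota> (Edge12 True 0)"])
      (use line indep_joints in \<open>auto simp: L_def eq\<close>)
  have base_ends: "ends H (\<iota> (Edge01 c)) = {x0, x1}" if "c \<le> Suc m" for c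
    using that by (intro ends(1)) (auto simp: L_def)
  have far_ends: "ends H (\<iota> (Edge02 s t)) = {x0, x2}" if "t \<le> N" for s t
    using that by (intro ends(2)) (auto simp: L_def)
  have near_ends: "ends H (\<iota> (Edge12 s t)) = {x1, x2}" if "t \<le> N" for s t
    using that by (intro ends(3)) (auto simp: L_def)
  define \<beta> where "\<beta> c = \<sigma> (\<iota> (Edge01 c)) x0 x1" for c
  define \<gamma> where "\<gamma> s t = \<sigma> (\<iota> (Edge02 s t)) x0 x2" for s t
  define \<eta> where "\<eta> s t = \<sigma> (\<iota> (Edge12 s t)) x1 x2" for s t
  have \<beta>: "\<beta> c \<in> carrier G" if "c \<le> Suc m" for c
    using gaining_carrier(1)[OF gaining _ base_ends] that by (simp add: \<beta>_def edges)
  have \<gamma>: "\<gamma> s t \<in> carrier G" if "t \<le> N" for s t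
    using gaining_carrier(1)[OF gaining _ far_ends] that by (simp add: \<gamma>_def edges)
  have \<eta>: "\<eta> s t \<in> carrier G" if "t \<le> N" for s t
    using gaining_carrier(1)[OF gaining _ near_ends] that by (simp add: \<eta>_def edges)
  \<comment> \<open>A prescribed triple is dependent, has independent pairs and covers three
    vertices of \<open>H\<close>, so it is a balanced triangle there.\<close>
  have tri: "\<beta> c \<otimes> \<eta> s u = \<gamma> s t" if "triangle (k s) c u t" for s c u t
  proof -
    have le: "c \<le> Suc m" "u \<le> N" "t \<le> N" using that by (auto simp: triangle_def)
    let ?b = "\<iota> (Edge01 c)" and ?f = "\<iota> (Edge12 s u)" and ?g = "\<iota> (Edge02 s t)"
    have "\<not> gg.indep {?b, ?f, ?g}"
      using that unfolding eq amalgamated_def tri_set_def by auto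
    moreover have "gg.indep {?b, ?f}" "gg.indep {?f, ?g}" "gg.indep {?b, ?g}"
      unfolding eq using le by (auto intro!: indep_pair)
    moreover have "covered H {?b, ?f, ?g} = {x0, x1, x2}"
      using le base_ends near_ends far_ends by (auto simp: covered_def)
    ultimately have "{?b, ?f, ?g} \<in> balanced_cycles G H \<sigma>"
      using gg.dependent_triple[of ?b ?f ?g] le dist by (simp add: edges)
    then show ?thesis
      using triangle_balanced_iff[OF is_group graph gaining _ _ _ base_ends near_ends far_ends dist] le
      by (simp add: edges \<beta>_def \<gamma>_def \<eta>_def)
  qed
  \<comment> \<open>Gains along 01 relative to edge 0. \<open>T c\<close> acts by left
    multiplication on the gains of the edges 02, and it is common to both halves.\<close>
  define T where "T c = \<beta> c \<otimes> inv (\<beta> 0)" for c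
  have T: "T c \<in> carrier G" if "c \<le> Suc m" for c
    using \<beta> that by (simp add: T_def)
  have step: "T c \<otimes> \<gamma> s u = \<gamma> s t" if "triangle (k s) c u t" for s c u t
  proof -
    have le: "c \<le> Suc m" "u \<le> N" "t \<le> N" using that by (auto simp: triangle_def)
    \<comment> \<open>The gain \<one> at index 0 ties the edges 12 and 02 of equal index together,
      which eliminates \<eta>.\<close>
    have "triangle (k s) 0 u u"
      using le w_carrier by (simp add: triangle_def base_gain_def)
    then have "\<gamma> s u = \<beta> 0 \<otimes> \<eta> s u" using tri by simp
    then have "T c \<otimes> \<gamma> s u = \<beta> c \<otimes> (inv (\<beta> 0) \<otimes> (\<beta> 0 \<otimes> \<eta> s u))"
      using \<beta> \<eta> le by (simp add: T_def m_assoc)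
    also have "\<dots> = \<beta> c \<otimes> \<eta> s u"
      using \<beta>[of 0] \<eta> le by (simp add: inv_solve_left' flip: m_assoc)
    finally show ?thesis using tri[OF that] by simp
  qed
  \<comment> \<open>The word \<open>w\<close> spelled with \<open>T\<close> in place of the letters;
    \<open>Suc\<close> because \<open>a i\<close> sits at index \<open>Suc i\<close>.\<close>
  define W where "W = rec_nat \<one> (\<lambda>t. (\<otimes>) (T (Suc (r t))))"
  have W_simps: "W 0 = \<one>" "W (Suc t) = T (Suc (r t)) \<otimes> W t" for t
    by (simp_all add: W_def)
  have W: "W t \<in> carrier G" if "t \<le> N" for t
    using that
  proof (induction t)
    case (Suc t)
    then show ?case using T[of "Suc (r t)"] r_less[of t] by (simp add: W_simps)
  qed (simp add: W_simps)
  have \<gamma>_W: "\<gamma> s t = W t \<otimes> \<gamma> s 0" if "t \<le> N" for s t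
    using that
  proof (induction t)
    case 0
    then show ?case using \<gamma> by (simp add: W_simps)
  next
    case (Suc t)
    then have r: "r t < m" and t: "t \<le> N" using r_less by auto
    have "triangle (k s) (Suc (r t)) t (Suc t)"
      using Suc.prems r w_Suc by (simp add: triangle_def base_gain_def)
    then have "\<gamma> s (Suc t) = T (Suc (r t)) \<otimes> (W t \<otimes> \<gamma> s 0)"
      using step[of s] Suc.IH[OF t] by metis
    then show ?case
      using T[of "Suc (r t)"] r W[OF t] \<gamma>[of 0 s] by (simp add: W_simps m_assoc)
  qed
  \<comment> \<open>The last edge 01 takes \<open>w 0\<close>, which is \<one>, to
    \<open>w (k s)\<close>.\<close>
  have last: "T (Suc m) = W (k s)" for s
  proof -
    have "triangle (k s) (Suc m) 0 (k s)"
      using assms(2) w_carrier by (simp add: triangle_def base_gain_def w_0)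
    then have "T (Suc m) \<otimes> \<gamma> s 0 = W (k s) \<otimes> \<gamma> s 0"
      using step \<gamma>_W assms(2) by metis
    then show ?thesis
      using T[of "Suc m"] W[OF assms(2)] \<gamma>[of 0 s] by simp
  qed
  show ?thesis
  proof (rule ccontr)
    assume ne: "k False \<noteq> k True"
    \<comment> \<open>Both stages of \<open>W\<close> equal \<open>T (Suc m)\<close>; inside the
      left half alone they yield two edges 02 of the same gain.\<close>
    have "\<gamma> False (k False) = \<gamma> False (k True)"
      using \<gamma>_W assms(2) last[of False] last[of True] by metis
    then have "{\<iota> (Edge02 False (k False)), \<iota> (Edge02 False (k True))} \<in> balanced_cycles G H \<sigma>"
      using digon_balanced_iff[OF is_group graph gaining _ _ _ far_ends far_ends] assms(2) dist ne
      by (simp add: edges \<gamma>_def)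
    moreover have "gg.indep {\<iota> (Edge02 False (k False)), \<iota> (Edge02 False (k True))}"
      unfolding eq using assms(2) by (intro indep_pair) auto
    ultimately show False
      unfolding frame_independent_iff[OF graph] by blast
  qed
qed

section \<open>Types of subsets of the left half\<close>

definition left :: "'e set" where
  "left = \<iota> ` {p \<in> points. \<exists>t. p = Edge02 False t \<or> p = Edge12 False t}"

text \<open>Capping the cardinality at \<open>4\<close> bounds the number of types and loses nothing, the rank
  being at most \<open>3\<close>.\<close>

definition left_type :: "nat \<Rightarrow> 'e set \<Rightarrow> (nat \<times> nat set) set \<times> nat set" where
  "left_type i X = ((\<lambda>Y. (min 4 (card Y), span Y)) ` Pow X,
     {c. \<exists>u t. triangle i c u t \<and> {\<iota> (Edge12 False u), \<iota> (Edge02 False t)} \<subseteq> X})"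

text \<open>What remains of independence once the left half is known only by its type. The left
  index \<open>i\<close> no longer occurs, so this is one context for all left halves.\<close>

definition right_test :: "nat \<Rightarrow> (nat \<times> nat set) set \<times> nat set \<Rightarrow> 'e set \<Rightarrow> bool" where
  "right_test j q Z \<longleftrightarrow> (\<forall>(n, U) \<in> fst q. \<forall>Y \<subseteq> Z. n + card Y \<le> card (U \<union> span Y)) \<and>
     (\<forall>c \<in> snd q. \<iota> (Edge01 c) \<notin> Z) \<and> (\<forall>c u t. triangle j c u t \<longrightarrow> \<not> tri_set True c u t \<subseteq> Z)"

text \<open>The number \<open>m\<close> of letters may vary with the length of the word, hence the
  uniform bound \<open>K\<close>; the length \<open>N\<close> does not enter the range.\<close>

lemma left_type_range:
  assumes "m \<le> K"
  shows "left_type i ` Pow left \<subseteq> Pow ({..4} \<times> Pow {0, 1, 2}) \<times> Pow {..Suc K}"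
proof -
  have "left_type i X \<in> Pow ({..4} \<times> Pow {0, 1, 2}) \<times> Pow {..Suc K}" if X: "X \<subseteq> left" for X
  proof -
    have "X \<subseteq> \<iota> ` points" using X by (auto simp: left_def)
    then have "span Y \<subseteq> {0, 1, 2}" if "Y \<subseteq> X" for Y
      using that by (intro span_le_3) auto
    then show ?thesis
      using assms by (auto simp: left_type_def triangle_def)
  qed
  then show ?thesis by blast
qed

text \<open>The joints and the edges 01 are on the right of the split. A left triangle becomes a
  pair in \<open>left\<close> that forbids one edge 01, a right triangle misses \<open>left\<close>,
  and the edge count is additive over the two parts.\<close>

lemma amalgamated_eq_amalgam:
  "amalgamated (\<lambda>s. if s then j else i) =
     amalgam left (\<iota> ` points - left) (left_type i) (right_test j)"
proof -
  have left_sub: "left \<subseteq> \<iota> ` points" by (auto simp: left_def)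
  then have E: "left \<union> (\<iota> ` points - left) = \<iota> ` points" by blast
  have test: "((\<forall>Y \<subseteq> Z. card Y \<le> card (span Y)) \<and>
      (\<forall>s c u t. triangle (if s then j else i) c u t \<longrightarrow> \<not> tri_set s c u t \<subseteq> Z)) \<longleftrightarrow>
      right_test j (left_type i (Z \<inter> left)) (Z \<inter> (\<iota> ` points - left))" if Z: "Z \<subseteq> \<iota> ` points" for Z
  proof -
    let ?R = "\<iota> ` points - left"
    have fin: "finite Y" if "Y \<subseteq> Z" for Y
      using that Z finite_points by (meson finite_imageI finite_subset)
    have le3: "card (span Y) \<le> 3" if "Y \<subseteq> Z" for Y
    proof -
      have "card (span Y) \<le> card {0, 1, 2 :: nat}"
        using that Z by (intro card_mono span_le_3) auto
      then show ?thesis by simp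
    qed
    have sparse: "(\<forall>Y \<subseteq> Z. card Y \<le> card (span Y)) \<longleftrightarrow>
        (\<forall>X \<subseteq> Z \<inter> left. \<forall>Y \<subseteq> Z \<inter> ?R. min 4 (card X) + card Y \<le> card (span X \<union> span Y))" (is "?A \<longleftrightarrow> ?B")
    proof
      assume ?A
      show ?B
      proof (intro allI impI)
        fix X Y assume XY: "X \<subseteq> Z \<inter> left" "Y \<subseteq> Z \<inter> ?R"
        then have "card (X \<union> Y) \<le> card (span (X \<union> Y))" using \<open>?A\<close> by blast
        moreover have "card (X \<union> Y) = card X + card Y"
          using XY fin by (intro card_Un_disjoint) auto
        moreover have "span (X \<union> Y) = span X \<union> span Y" by (auto simp: span_def)
        ultimately show "min 4 (card X) + card Y \<le> card (span X \<union> span Y)" by simp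
      qed
    next
      assume ?B
      show ?A
      proof (intro allI impI)
        fix Y assume Y: "Y \<subseteq> Z"
        have YR: "Y \<inter> ?R = Y - left" using Y Z by blast
        have "Y \<inter> left \<subseteq> Z \<inter> left" "Y - left \<subseteq> Z \<inter> ?R" using Y YR by auto
        then have "min 4 (card (Y \<inter> left)) + card (Y - left) \<le> card (span (Y \<inter> left) \<union> span (Y - left))"
          using \<open>?B\<close> by simp
        moreover have "span (Y \<inter> left) \<union> span (Y - left) = span Y"
          unfolding span_def by blast
        moreover have "card Y = card (Y \<inter> left) + card (Y - left)"
          by (rule card_Int_Diff[OF fin[OF Y]])
        \<comment> \<open>If the cap applied, the left side would be at least 4, but the span has at
          most three vertices.\<close>
        ultimately show "card Y \<le> card (span Y)"
          using le3[OF Y] by (simp add: min_def split: if_splits)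
      qed
    qed
    have left_iff: "(\<forall>c u t. triangle i c u t \<longrightarrow> \<not> tri_set False c u t \<subseteq> Z) \<longleftrightarrow>
        (\<forall>c \<in> snd (left_type i (Z \<inter> left)). \<iota> (Edge01 c) \<notin> Z \<inter> ?R)"
    proof -
      have iff: "tri_set False c u t \<subseteq> Z \<longleftrightarrow>
          {\<iota> (Edge12 False u), \<iota> (Edge02 False t)} \<subseteq> Z \<inter> left \<and> \<iota> (Edge01 c) \<in> Z \<inter> ?R"
        if "triangle i c u t" for c u t
        using that by (auto simp: tri_set_def left_def triangle_def)
      have mem: "c \<in> snd (left_type i (Z \<inter> left)) \<longleftrightarrow> (\<exists>u t. triangle i c u t \<and>
          {\<iota> (Edge12 False u), \<iota> (Edge02 False t)} \<subseteq> Z \<inter> left)" for c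
        by (simp add: left_type_def)
      show ?thesis
      proof
        assume *: "\<forall>c u t. triangle i c u t \<longrightarrow> \<not> tri_set False c u t \<subseteq> Z"
        show "\<forall>c \<in> snd (left_type i (Z \<inter> left)). \<iota> (Edge01 c) \<notin> Z \<inter> ?R"
        proof (intro ballI notI)
          fix c assume c: "c \<in> snd (left_type i (Z \<inter> left))" and base: "\<iota> (Edge01 c) \<in> Z \<inter> ?R"
          obtain u t where tri: "triangle i c u t"
            and edges: "{\<iota> (Edge12 False u), \<iota> (Edge02 False t)} \<subseteq> Z \<inter> left"
            using c unfolding mem by blast
          have "tri_set False c u t \<subseteq> Z"
            unfolding iff[OF tri] using edges base by simp
          then show False using * tri by blast
        qed
      next
        assume *: "\<forall>c \<in> snd (left_type i (Z \<inter> left)). \<iota> (Edge01 c) \<notin> Z \<inter> ?R"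
        show "\<forall>c u t. triangle i c u t \<longrightarrow> \<not> tri_set False c u t \<subseteq> Z"
        proof (intro allI impI notI)
          fix c u t assume tri: "triangle i c u t" and sub: "tri_set False c u t \<subseteq> Z"
          from sub have edges: "{\<iota> (Edge12 False u), \<iota> (Edge02 False t)} \<subseteq> Z \<inter> left"
            and base: "\<iota> (Edge01 c) \<in> Z \<inter> ?R"
            unfolding iff[OF tri] by auto
          have "c \<in> snd (left_type i (Z \<inter> left))"
            unfolding mem using tri edges by blast
          then show False using * base by blast
        qed
      qed
    qed
    have right: "tri_set True c u t \<subseteq> Z \<longleftrightarrow> tri_set True c u t \<subseteq> Z \<inter> ?R" for c u t
    proof -
      have "tri_set True c u t \<inter> left = {}"
        by (auto simp: tri_set_def left_def)
      then show ?thesis using Z by blast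
    qed
    have sides: "(\<forall>s c u t. triangle (if s then j else i) c u t \<longrightarrow> \<not> tri_set s c u t \<subseteq> Z) \<longleftrightarrow>
        (\<forall>c u t. triangle i c u t \<longrightarrow> \<not> tri_set False c u t \<subseteq> Z) \<and>
        (\<forall>c u t. triangle j c u t \<longrightarrow> \<not> tri_set True c u t \<subseteq> Z \<inter> ?R)"
      unfolding right[symmetric] all_bool_eq by auto
    have types: "(\<forall>(n, U) \<in> fst (left_type i X). \<forall>Y \<subseteq> X'. n + card Y \<le> card (U \<union> span Y)) \<longleftrightarrow>
        (\<forall>W \<subseteq> X. \<forall>Y \<subseteq> X'. min 4 (card W) + card Y \<le> card (span W \<union> span Y))" for X X'
      unfolding left_type_def fst_conv by (simp add: image_iff) blast
    show ?thesis
      unfolding right_test_def types sparse left_iff[symmetric] sides by (rule refl)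
  qed
  show ?thesis
    unfolding amalgamated_def amalgam_def E by (simp only: test cong: conj_cong)
qed

end

section \<open>The contradiction for a defining sentence\<close>

theorem theorem5p7:
  fixes \<Gamma> :: "('g, 'm) monoid_scheme"
  assumes "group \<Gamma>"
    and "infinite (carrier \<Gamma>)"
    and "\<not> uniformly_locally_finite \<Gamma>"
    and "infinite (UNIV :: 'e set)"
  shows "\<not> cmso1_definable (gain_graphic_matroids \<Gamma> :: 'e hypergraph set)"
proof
  interpret group \<Gamma> by fact
  assume "cmso1_definable (gain_graphic_matroids \<Gamma> :: 'e hypergraph set)"
  then obtain \<phi> where \<phi>: "is_sentence \<phi>"
    "\<And>H :: 'e hypergraph. is_hypergraph H \<Longrightarrow> satisfies H \<phi> \<longleftrightarrow> H \<in> gain_graphic_matroids \<Gamma>"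
    unfolding cmso1_definable_def by blast
  obtain k where k: "\<And>N. \<exists>S w. S \<subseteq> carrier \<Gamma> \<and> finite S \<and> card S \<le> k \<and> \<one>\<^bsub>\<Gamma>\<^esub> \<notin> S \<and> w 0 = \<one>\<^bsub>\<Gamma>\<^esub> \<and>
    (\<forall>t < N. \<exists>s \<in> S. w (Suc t) = s \<otimes>\<^bsub>\<Gamma>\<^esub> w t) \<and> w ` {..N} \<subseteq> carrier \<Gamma> \<and> inj_on w {..N} \<and>
    (\<forall>t. 2 \<le> t \<and> t \<le> N \<longrightarrow> w t \<notin> insert \<one>\<^bsub>\<Gamma>\<^esub> S)"
    using long_geodesic_words[OF assms(3)] by blast
  \<comment> \<open>The set of types is fixed by \<open>k\<close> alone, before \<open>b\<close> and
    then \<open>N\<close> are chosen.\<close>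
  let ?Q = "Pow ({..4 :: nat} \<times> Pow {0, 1, 2 :: nat}) \<times> Pow {..Suc k}"
  have "finite ?Q" by simp
  from sentence_pigeonhole[OF this \<phi>(1)] obtain b
    where b: "\<And>A B (\<alpha> :: nat \<Rightarrow> 'e set \<Rightarrow> (nat \<times> nat set) set \<times> nat set).
      finite A \<Longrightarrow> finite B \<Longrightarrow> A \<inter> B = {} \<Longrightarrow> \<forall>i. \<alpha> i ` Pow A \<subseteq> ?Q \<Longrightarrow>
      \<exists>i j. i < j \<and> j \<le> b \<and> (\<forall>P. satisfies (amalgam A B (\<alpha> i) P) \<phi> \<longleftrightarrow> satisfies (amalgam A B (\<alpha> j) P) \<phi>)"
    by metis
  \<comment> \<open>Room for the indices up to \<open>b\<close> after a shift by 2, which avoids the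
    stages \<open>w 0\<close> and \<open>w 1\<close>.\<close>
  define N where "N = b + 2"
  obtain S w where S: "S \<subseteq> carrier \<Gamma>" "finite S" "card S \<le> k" "\<one>\<^bsub>\<Gamma>\<^esub> \<notin> S"
    and w: "w 0 = \<one>\<^bsub>\<Gamma>\<^esub>" "\<forall>t < N. \<exists>s \<in> S. w (Suc t) = s \<otimes>\<^bsub>\<Gamma>\<^esub> w t" "inj_on w {..N}"
      "\<forall>t. 2 \<le> t \<and> t \<le> N \<longrightarrow> w t \<notin> insert \<one>\<^bsub>\<Gamma>\<^esub> S"
    using k[of N] by blast
  obtain a where "bij_betw a {0..<card S} S"
    using ex_bij_betw_nat_finite[OF S(2)] by blast
  then have a: "inj_on a {..<card S}" "a ` {..<card S} = S"
    by (simp_all add: bij_betw_def atLeast0LessThan)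
  have "\<forall>t. \<exists>i. t < N \<longrightarrow> i < card S \<and> w (Suc t) = a i \<otimes>\<^bsub>\<Gamma>\<^esub> w t"
    using w(2) a(2) by (metis (no_types, lifting) imageE lessThan_iff)
  then obtain r where r: "\<And>t. t < N \<Longrightarrow> r t < card S \<and> w (Suc t) = a (r t) \<otimes>\<^bsub>\<Gamma>\<^esub> w t"
    by metis
  obtain f :: "nat \<Rightarrow> 'e" where "inj f"
    using infinite_countable_subset[OF assms(4)] by blast
  then have \<iota>: "inj (f \<circ> (to_nat :: point \<Rightarrow> nat))"
    by (intro inj_compose) auto
  have a_mem: "a i \<in> S" if "i < card S" for i
    using that a(2) by blast
  interpret word_matroid \<Gamma> "card S" N a w r "f \<circ> to_nat"
  proof
    show "2 \<le> N" by (simp add: N_def)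
    show "a i \<in> carrier \<Gamma>" "a i \<noteq> \<one>\<^bsub>\<Gamma>\<^esub>" if "i < card S" for i
      using a_mem[OF that] S(1,4) by auto
  qed (use a w r \<iota> in auto)
  let ?R = "(f \<circ> to_nat) ` points - left"
  have "finite left" "finite ?R"
    using finite_points by (auto simp: left_def)
  then obtain i j where ij: "i < j" "j \<le> b"
    "\<And>P. satisfies (amalgam left ?R (left_type (i + 2)) P) \<phi> \<longleftrightarrow>
         satisfies (amalgam left ?R (left_type (j + 2)) P) \<phi>"
    using b[of left ?R "\<lambda>i. left_type (i + 2)"] left_type_range[OF S(3)] by blast
  have hyp: "is_hypergraph (amalgamated k)" for k
    using finite_points by (auto simp: is_hypergraph_def amalgamated_def)
  \<comment> \<open>The redundant \<open>if\<close> fits the form of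
    \<open>amalgamated_eq_amalgam\<close>; afterwards only the left index is exchanged for
    \<open>j + 2\<close>.\<close>
  have "amalgamated (\<lambda>s. if s then i + 2 else i + 2) \<in> gain_graphic_matroids \<Gamma>"
    using diagonal_gain_graphic[OF assms(2), of "i + 2"] ij by (simp add: N_def)
  then have "satisfies (amalgamated (\<lambda>s. if s then i + 2 else i + 2)) \<phi>"
    by (rule \<phi>(2)[OF hyp, THEN iffD2])
  then have "satisfies (amalgamated (\<lambda>s. if s then i + 2 else j + 2)) \<phi>"
    unfolding amalgamated_eq_amalgam ij(3) .
  then have "amalgamated (\<lambda>s. if s then i + 2 else j + 2) \<in> gain_graphic_matroids \<Gamma>"
    by (rule \<phi>(2)[OF hyp, THEN iffD1])
  moreover have "(if s then i + 2 else j + 2) \<le> N" for s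
    using ij by (simp add: N_def)
  ultimately have "(if False then i + 2 else j + 2) = (if True then i + 2 else j + 2)"
    by (rule gain_graphic_imp_diagonal)
  then show False using ij(1) by simp
qed

end
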